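(* Let $\Lambda$ and $\Lambda^\sigma$ be the period lattices of $\Psi$ and $\Psi^\sigma$. Then $\Lambda=\xi_{\mathcal A}\cdot\mathcal A$ and $\Lambda^\sigma=T\ell\xi_{\mathcal A}\cdot I_\infty^{-1}$, where \[ \xi_{\mathcal A}=\frac{\sqrt[q-1]{-[2]}\;T^{\sigma-1}}{[1]}\prod_{i=1}^\infty\Big(1-\frac{[i]}{[i+2]}\Big) \] with $\sqrt[q-1]{-[2]}$ a $(q-1)$-th root of $-[2]$, and $\ell$ is a $(q-1)$-th root of $T^{\sigma-1}$.
   Context: Let $q$ be a prime power, $\zeta\in\mathbb F_{q^2}\setminus\mathbb F_q$, $\pi(t)=(t-\zeta)(t-\zeta^q)$, $K=\mathbb F_q(t)$, $x=1/\pi$, $y=t/\pi$, $\mathcal A=\mathbb F_q[x,y]$, $I_\infty=(x,y)\subset\mathcal A$ and $I_\infty^{-1}=\{z\in K: zI_\infty\subseteq\mathcal A\}$. $T=1/(t-\zeta^q)$, $T^\sigma=1/(t-\zeta)$, $T^{a+b\sigma}:=T^a(T^\sigma)^b$; for $k\ge1$, $[2k]=T^{q^{2k}}-T$, $[2k-1]=T^{q^{2k-1}}-T^\sigma$. $\mathbb C_\infty$ is the completion of an algebraic closure of $\mathbb F_{q^2}((1/T))$ w.r.t. the $1/T$-adic valuation, with $K$ embedded via $t=\zeta^q+1/T$. With $\tau$ the $q$-Frobenius, the rank one Drinfeld modules over $\mathbb C_\infty$ are \[ \Psi_x=T^{\sigma-1}\tau^2+(T^\sigma+T^{q-1+\sigma})\tau+x,\quad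 \Psi_y=\zeta T^{\sigma-1}\tau^2+(tT^\sigma+\zeta T^{q-1+\sigma})\tau+y, \] \[ \Psi^\sigma_x=T^{1-\sigma}\tau^2+(T+T^{(q-1)\sigma+1})\tau+x,\quad \Psi^\sigma_y=\zeta^qT^{1-\sigma}\tau^2+(tT+\zeta^qT^{(q-1)\sigma+1})\tau+y. \] The period lattice of a Drinfeld module $\phi$ over $\mathbb C_\infty$ is the kernel of its exponential, the unique entire $\mathbb F_q$-linear series $X+\sum_{j\ge1}c_jX^{q^j}$ with $\phi_a(\exp(X))=\exp(aX)$ for all $a\in\mathcal A$. *)

theory Defs
  imports
    "HOL-Analysis.Analysis"
    "HOL-Algebra.Algebraic_Closure_Type"
    "HOL-Computational_Algebra.Formal_Laurent_Series"
    "HOL-Number_Theory.Prime_Powers"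
begin

section \<open>Completion of an algebraic closure of a Laurent series field\<close>

text \<open>
  \<open>is_completed_alg_closure \<iota>\<close> says that the metric field \<open>'c\<close> is, via \<open>\<iota>\<close>, the completion of the
  algebraic closure of \<open>'k((X))\<close> for the unique extension of the \<open>X\<close>-adic absolute value.
  The absolute value on \<open>'c\<close> is \<open>\<lambda>u. dist u 0\<close>: the class \<open>real_normed_field\<close> is unusable here,
  since it forces characteristic zero.  Completeness is the class \<open>complete_space\<close>.  The base
  \<open>b\<close> normalises the absolute value and is arbitrary.
\<close>

definition is_completed_alg_closure ::
  "('k::field fls alg_closure \<Rightarrow> 'c::{field, complete_space}) \<Rightarrow> bool" where
  "is_completed_alg_closure \<iota> \<longleftrightarrow>
     \<iota> 1 = 1 \<and> (\<forall>u v. \<iota> (u + v) = \<iota> u + \<iota> v) \<and> (\<forall>u v. \<iota> (u * v) = \<iota> u * \<iota> v) \<and>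
     (\<forall>u v :: 'c. dist u v = dist (u - v) 0) \<and>
     (\<forall>u v :: 'c. dist (u * v) 0 = dist u 0 * dist v 0) \<and>
     (\<forall>u v :: 'c. dist (u + v) 0 \<le> max (dist u 0) (dist v 0)) \<and>
     (\<exists>b>1. \<forall>f. f \<noteq> 0 \<longrightarrow> dist (\<iota> (to_ac f)) 0 = b powi (- fls_subdegree f)) \<and>
     closure (range \<iota>) = UNIV"

definition const_embed :: "('k::field fls alg_closure \<Rightarrow> 'c) \<Rightarrow> 'k \<Rightarrow> 'c" where
  "const_embed \<iota> a = \<iota> (to_ac (fls_const a))"

text \<open>\<open>\<F>\<^sub>q\<close> inside the finite field \<open>'k\<close> of order \<open>q\<^sup>2\<close> is the fixed field of \<open>a \<mapsto> a\<^sup>q\<close>.\<close>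

definition Fq :: "nat \<Rightarrow> 'k::field set" where
  "Fq q = {a. a ^ q = a}"


section \<open>Subrings, fractions and ideals inside a field\<close>

inductive_set adjoin :: "'c::field set \<Rightarrow> 'c set \<Rightarrow> 'c set" for F S where
  scalar: "a \<in> F \<Longrightarrow> a \<in> adjoin F S"
| gen: "a \<in> S \<Longrightarrow> a \<in> adjoin F S"
| add: "a \<in> adjoin F S \<Longrightarrow> b \<in> adjoin F S \<Longrightarrow> a + b \<in> adjoin F S"
| mult: "a \<in> adjoin F S \<Longrightarrow> b \<in> adjoin F S \<Longrightarrow> a * b \<in> adjoin F S"

definition fraction_subfield :: "'c::field set \<Rightarrow> 'c set" where
  "fraction_subfield R = {a / b | a b. a \<in> R \<and> b \<in> R \<and> b \<noteq> 0}"

definition ideal_gen2 :: "'c::field set \<Rightarrow> 'c \<Rightarrow> 'c \<Rightarrow> 'c set" where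
  "ideal_gen2 A x y = {a * x + b * y | a b. a \<in> A \<and> b \<in> A}"

definition inverse_ideal :: "'c::field set \<Rightarrow> 'c set \<Rightarrow> 'c set \<Rightarrow> 'c set" where
  "inverse_ideal K A I = {z \<in> K. \<forall>w\<in>I. z * w \<in> A}"


section \<open>Drinfeld modules, exponentials and period lattices\<close>

text \<open>
  An element \<open>\<Sum>\<^sub>i P\<^sub>i \<tau>\<^sup>i\<close> of the twisted polynomial ring is stored as the ordinary polynomial with
  the same coefficients.  Addition is then that of \<open>'c poly\<close>, but multiplication is \<open>tau_mult\<close>,
  determined by \<open>\<tau> c = c\<^sup>q \<tau>\<close>.
\<close>

definition tau_mult :: "nat \<Rightarrow> 'c::field poly \<Rightarrow> 'c poly \<Rightarrow> 'c poly" where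
  "tau_mult q P Q =
     (\<Sum>i\<le>Polynomial.degree P. \<Sum>j\<le>Polynomial.degree Q. Polynomial.monom (poly.coeff P i * poly.coeff Q j ^ (q ^ i)) (i + j))"

definition tau_eval :: "nat \<Rightarrow> 'c::field poly \<Rightarrow> 'c \<Rightarrow> 'c" where
  "tau_eval q P z = (\<Sum>i\<le>Polynomial.degree P. poly.coeff P i * z ^ (q ^ i))"

text \<open>
  \<open>F\<close> is the (embedded) field of \<open>q\<close> elements and \<open>A\<close> the coefficient ring, both subsets of \<open>'c\<close>;
  the values of \<open>\<phi>\<close> outside \<open>A\<close> are irrelevant.
\<close>

definition drinfeld_module ::
  "nat \<Rightarrow> 'c::field set \<Rightarrow> 'c set \<Rightarrow> ('c \<Rightarrow> 'c poly) \<Rightarrow> bool" where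
  "drinfeld_module q F A \<phi> \<longleftrightarrow>
     (\<forall>a\<in>A. \<forall>b\<in>A. \<phi> (a + b) = \<phi> a + \<phi> b) \<and>
     (\<forall>a\<in>A. \<forall>b\<in>A. \<phi> (a * b) = tau_mult q (\<phi> a) (\<phi> b)) \<and>
     (\<forall>c\<in>F. \<phi> c = [:c:]) \<and>
     (\<forall>a\<in>A. poly.coeff (\<phi> a) 0 = a) \<and>
     (\<exists>a\<in>A. \<phi> a \<noteq> [:a:])"

text \<open>\<open>c\<close> is the coefficient sequence of the series \<open>\<Sum>\<^sub>j c\<^sub>j X\<^bsup>q\<^sup>j\<^esup>\<close>.\<close>

definition is_exp_coeffs ::
  "nat \<Rightarrow> 'c::{field, complete_space} set \<Rightarrow> ('c \<Rightarrow> 'c poly) \<Rightarrow> (nat \<Rightarrow> 'c) \<Rightarrow> bool" where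
  "is_exp_coeffs q A \<phi> c \<longleftrightarrow>
     c 0 = 1 \<and>
     (\<forall>z. summable (\<lambda>j. c j * z ^ (q ^ j))) \<and>
     (\<forall>a\<in>A. \<forall>z. tau_eval q (\<phi> a) (\<Sum>j. c j * z ^ (q ^ j)) = (\<Sum>j. c j * (a * z) ^ (q ^ j)))"

definition drinfeld_exp ::
  "nat \<Rightarrow> 'c::{field, complete_space} set \<Rightarrow> ('c \<Rightarrow> 'c poly) \<Rightarrow> 'c \<Rightarrow> 'c" where
  "drinfeld_exp q A \<phi> z = (\<Sum>j. (THE c. is_exp_coeffs q A \<phi> c) j * z ^ (q ^ j))"

definition period_lattice ::
  "nat \<Rightarrow> 'c::{field, complete_space} set \<Rightarrow> ('c \<Rightarrow> 'c poly) \<Rightarrow> 'c set" where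
  "period_lattice q A \<phi> = {z. drinfeld_exp q A \<phi> z = 0}"

text \<open>The elements \<open>[n]\<close>, used for \<open>n \<ge> 1\<close> only; \<open>Ts\<close> stands for \<open>T\<^sup>\<sigma>\<close>.\<close>

definition bracket :: "nat \<Rightarrow> 'c::field \<Rightarrow> 'c \<Rightarrow> nat \<Rightarrow> 'c" where
  "bracket q T Ts n = (if even n then T ^ (q ^ n) - T else T ^ (q ^ n) - Ts)"

end

(* The exponentials are explicit: with u_i(w) = prod_{j<i} (t^(q^i) - w^(q^j)) / (t^(q^i) - t^(q^j)),
   the series sum_i u_i(w) eta^(q^i - 1) X^(q^i) satisfies the functional equations of Psi for
   w = zeta^q and of Psi^sigma for w = zeta, as soon as eta^(q-1) = -(t - w).  Lagrange interpolation
   at the points t, t^q, ..., t^(q^m) kills sum_i P(t^(q^i)) / prod_{j/=i} (t^(q^i) - t^(q^j)) for every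
   polynomial P of degree < m.  For P = ((X - zeta)(X - zeta^q))^n, times 1 or X in the case of
   Psi^sigma, the limit over n shows that the claimed generators are periods; the product
   B = prod_j T^(q^(j+1)) / [j+1] that arises has B^(q-1) expressible through prod (1 - [i]/[i+2]).
   Conversely, let mu be a zero of E(X) = exp(omega X).  Since the x-torsion polynomial has degree q^2,
   some explicit lattice point r satisfies E((mu - r)/x) = 0.  As |x| > 1, repeating this brings
   the zero into the closed unit disc, where the first terms of the series dominate and determine
   all zeros. *)
theory Submission
  imports Defs "HOL-Number_Theory.Residues"
begin

section \<open>Complete ultrametric fields\<close>

text \<open>Why the coefficients have this shape: f(X) = 1/(X - w) - 1/(t - w) satisfies
  \<open>c_(i-1)^q = c_i * f(t^(q^i))\<close>. So the coefficients of exp^q and exp^(q^2) are c_i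
  times values of rational functions at X = t^(q^i), and a functional equation becomes one identity
  in X. Why interpolation meets a power of pi: the conjugates zeta^(q^k) alternate, so the
  numerators of u_i, completed by those of a Frobenius power of a partial product of B, form, up to
  an exchange of one factor, the same polynomial in t^(q^i) for every i. Dividing it by X - zeta or
  by pi brings the degree below the bound; this is the origin of 1/(t - zeta) and 1/pi in the
  periods. Why comparing (q-1)-th powers is enough: the exponential depends on eta only through
  eta^(q-1), and the (q-1)-th roots of unity lie in F_q, so they preserve the lattices. What
  separates the two modules is |t - zeta^q| < 1 = |t - zeta|: for Psi the closed unit disc contains
  the q zeros in F_q, and two terms of the series are needed to find them; for Psi^sigma the linear
  term settles the open disc, and one division by x leads into it.\<close>

locale ultrametric_field =
  fixes nm :: "'c::{field, complete_space} \<Rightarrow> real"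
  assumes dist_eq: "dist u v = nm (u - v)"
    and nm_mult [simp]: "nm (u * v) = nm u * nm v"
    and nm_add_le: "nm (u + v) \<le> max (nm u) (nm v)"
begin

lemma nm_eq_dist: "nm u = dist u 0"
  by (simp add: dist_eq)

lemma nm_nonneg [simp]: "0 \<le> nm u"
  by (simp add: nm_eq_dist)

lemma nm_0 [simp]: "nm 0 = 0"
  by (simp add: nm_eq_dist)

lemma nm_eq_0_iff [simp]: "nm u = 0 \<longleftrightarrow> u = 0"
  by (simp add: nm_eq_dist)

lemma nm_pos_iff [simp]: "0 < nm u \<longleftrightarrow> u \<noteq> 0"
  by (simp add: nm_eq_dist)

lemma nm_1 [simp]: "nm 1 = 1"
  using nm_mult[of 1 1] nm_eq_0_iff[of 1] by simp

lemma nm_minus [simp]: "nm (- u) = nm u"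
  by (metis diff_0 diff_zero dist_commute dist_eq)

lemma nm_diff_commute: "nm (u - v) = nm (v - u)"
  by (metis dist_commute dist_eq)

lemma nm_diff_le: "nm (u - v) \<le> max (nm u) (nm v)"
  using nm_add_le[of u "- v"] by simp

lemma nm_power [simp]: "nm (u ^ n) = nm u ^ n"
  by (induction n) auto

lemma nm_divide [simp]: "nm (u / v) = nm u / nm v"
proof (cases "v = 0")
  case False
  then show ?thesis using nm_mult[of "u / v" v] by (simp add: field_simps del: nm_mult)
qed simp

lemma nm_prod: "nm (prod f S) = (\<Prod>i\<in>S. nm (f i))"
  by (induction S rule: infinite_finite_induct) auto

lemma nm_add_le': "nm u \<le> C \<Longrightarrow> nm v \<le> C \<Longrightarrow> nm (u + v) \<le> C"
  using nm_add_le[of u v] by linarith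

lemma nm_diff_le': "nm u \<le> C \<Longrightarrow> nm v \<le> C \<Longrightarrow> nm (u - v) \<le> C"
  using nm_diff_le[of u v] by linarith

lemma nm_diff_less: "nm u < C \<Longrightarrow> nm v < C \<Longrightarrow> nm (u - v) < C"
  using nm_diff_le[of u v] by linarith

lemma nm_add_eq: "nm v < nm u \<Longrightarrow> nm (u + v) = nm u"
  using nm_add_le[of u v] nm_diff_le[of "u + v" v] by auto

lemma nm_diff_eq: "nm v < nm u \<Longrightarrow> nm (u - v) = nm u"
  using nm_add_eq[of "- v" u] by simp

lemma nm_sum_le: "0 \<le> C \<Longrightarrow> (\<And>i. i \<in> S \<Longrightarrow> nm (f i) \<le> C) \<Longrightarrow> nm (sum f S) \<le> C"
  by (induction S rule: infinite_finite_induct) (auto intro: nm_add_le')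

section \<open>Limits, series and infinite products for an ultrametric absolute value\<close>

lemma tendsto_iff_nm: "(U \<longlongrightarrow> L) G \<longleftrightarrow> ((\<lambda>n. nm (U n - L)) \<longlongrightarrow> 0) G"
  unfolding tendsto_dist_iff[of U] dist_eq ..

lemma nm_bounded_tendsto: "((\<lambda>n. a n) \<longlongrightarrow> 0) G \<Longrightarrow> (\<And>n. nm (U n - L) \<le> a n) \<Longrightarrow> (U \<longlongrightarrow> L) G"
  unfolding tendsto_iff_nm[of U] by (rule tendsto_sandwich[of "\<lambda>_. 0"]) auto

lemma tendsto_nm: "(U \<longlongrightarrow> L) G \<Longrightarrow> ((\<lambda>n. nm (U n)) \<longlongrightarrow> (nm L)) G"
  unfolding nm_eq_dist by (intro tendsto_intros)

lemma tendsto_add_nm: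
  assumes "(U \<longlongrightarrow> (L::'c)) G" "(V \<longlongrightarrow> M) G"
  shows "((\<lambda>n. U n + V n) \<longlongrightarrow> (L + M)) G"
proof (rule nm_bounded_tendsto)
  show "((\<lambda>n. nm (U n - L) + nm (V n - M)) \<longlongrightarrow> 0) G"
    using tendsto_add[OF assms[unfolded tendsto_iff_nm[of U] tendsto_iff_nm[of V]]] by simp
  show "nm (U n + V n - (L + M)) \<le> nm (U n - L) + nm (V n - M)" for n
    using nm_add_le'[of "U n - L" "nm (U n - L) + nm (V n - M)" "V n - M"] by (simp add: algebra_simps)
qed

lemma tendsto_cmult_nm:
  assumes "(U \<longlongrightarrow> (L::'c)) G"
  shows "((\<lambda>n. a * U n) \<longlongrightarrow> (a * L)) G"
proof (rule nm_bounded_tendsto)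
  show "((\<lambda>n. nm a * nm (U n - L)) \<longlongrightarrow> 0) G"
    using tendsto_mult_right_zero assms[unfolded tendsto_iff_nm[of U]] by blast
qed (simp flip: right_diff_distrib nm_mult)

lemma tendsto_mult_nm:
  assumes "(U \<longlongrightarrow> (L::'c)) G" "(V \<longlongrightarrow> M) G"
  shows "((\<lambda>n. U n * V n) \<longlongrightarrow> (L * M)) G"
proof -
  have "((\<lambda>n. nm (U n) * nm (V n - M)) \<longlongrightarrow> (nm L * 0)) G"
    using tendsto_mult[OF tendsto_nm[OF assms(1)] assms(2)[unfolded tendsto_iff_nm[of V]]] .
  then have "((\<lambda>n. U n * (V n - M)) \<longlongrightarrow> 0) G"
    by (simp add: tendsto_iff_nm)
  from tendsto_add_nm[OF this tendsto_cmult_nm[OF assms(1), of M]]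
  show ?thesis by (simp add: algebra_simps)
qed

lemma tendsto_power_nm: "(U \<longlongrightarrow> (L::'c)) G \<Longrightarrow> ((\<lambda>n. U n ^ k) \<longlongrightarrow> (L ^ k)) G"
  by (induction k) (auto intro: tendsto_mult_nm)

lemma nm_limit_le: "U \<longlonglongrightarrow> L \<Longrightarrow> (\<And>n. n \<ge> N \<Longrightarrow> nm (U n) \<le> C) \<Longrightarrow> nm L \<le> C"
  using tendsto_nm[of U L sequentially] by (metis LIMSEQ_le_const2)

lemma nm_diff_le_steps:
  fixes U :: "nat \<Rightarrow> 'c"
  assumes "M \<le> n" "\<And>k. k \<ge> M \<Longrightarrow> nm (U (Suc k) - U k) \<le> e" "0 \<le> e"
  shows "nm (U n - U M) \<le> e"
  using assms(1)
proof (induction n rule: dec_induct)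
  case (step n)
  have "nm ((U (Suc n) - U n) + (U n - U M)) \<le> e"
    using step assms by (intro nm_add_le') auto
  then show ?case by simp
qed (use assms in auto)

text \<open>A telescoping sum is bounded by its largest step, whatever its length, so vanishing
  steps already make the sequence Cauchy.\<close>

lemma convergent_if_steps:
  fixes U :: "nat \<Rightarrow> 'c"
  assumes "(\<lambda>n. nm (U (Suc n) - U n)) \<longlonglongrightarrow> 0"
  shows "convergent U"
proof -
  have "Cauchy U"
  proof (rule metric_CauchyI)
    fix e :: real assume "0 < e"
    then obtain M where M: "\<And>k. k \<ge> M \<Longrightarrow> nm (U (Suc k) - U k) < e / 2"
      using order_tendstoD(2)[OF assms, of "e / 2"] by (auto simp: eventually_sequentially)
    have *: "nm (U n - U M) \<le> e / 2" if "n \<ge> M" for n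
      by (rule nm_diff_le_steps) (use M \<open>0 < e\<close> that in \<open>auto intro: less_imp_le\<close>)
    have "dist (U m) (U n) < e" if "m \<ge> M" "n \<ge> M" for m n
    proof -
      have "nm ((U m - U M) - (U n - U M)) \<le> e / 2"
        using *[OF that(1)] *[OF that(2)] by (rule nm_diff_le')
      then show ?thesis using \<open>0 < e\<close> by (simp add: dist_eq)
    qed
    then show "\<exists>M. \<forall>m\<ge>M. \<forall>n\<ge>M. dist (U m) (U n) < e" by blast
  qed
  then show ?thesis by (rule Cauchy_convergent)
qed

lemma summable_if_tendsto_0: "f \<longlonglongrightarrow> (0::'c) \<Longrightarrow> summable f"
  using convergent_if_steps[of "\<lambda>n. sum f {..<n}"]
  by (simp add: summable_iff_convergent tendsto_iff_nm[of f])

lemma tendsto_0_if_summable: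
  assumes "summable f"
  shows "f \<longlonglongrightarrow> (0::'c)"
proof -
  from assms obtain s where s: "(\<lambda>n. sum f {..<n}) \<longlonglongrightarrow> s"
    by (auto simp: summable_def sums_def)
  from tendsto_add_nm[OF LIMSEQ_Suc[OF s] tendsto_cmult_nm[OF s, of "-1"]]
  show ?thesis by simp
qed

lemma sums_add_nm: "f sums s \<Longrightarrow> g sums t \<Longrightarrow> (\<lambda>n. f n + g n) sums (s + t :: 'c)"
  unfolding sums_def by (simp add: sum.distrib tendsto_add_nm)

lemma sums_cmult_nm: "f sums s \<Longrightarrow> (\<lambda>n. a * f n) sums (a * s :: 'c)"
  unfolding sums_def by (simp add: tendsto_cmult_nm flip: sum_distrib_left)

lemma sums_diff_nm: "f sums s \<Longrightarrow> g sums t \<Longrightarrow> (\<lambda>n. f n - g n) sums (s - t :: 'c)"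
  using sums_add_nm[of f s "\<lambda>n. -1 * g n" "-1 * t"] sums_cmult_nm[of g t "-1"] by simp

text \<open>The q-th power of an exponential series has its i-th coefficient at place i + 1; this
  shift lets it be added to the original series term by term.\<close>

lemma sums_shift:
  assumes "f sums (s::'c)"
  shows "(\<lambda>n. case n of 0 \<Rightarrow> 0 | Suc k \<Rightarrow> f k) sums s"
proof -
  have "sum (\<lambda>n. case n of 0 \<Rightarrow> 0 | Suc k \<Rightarrow> f k) {..<Suc n} = sum f {..<n}" for n
    by (simp add: sum.lessThan_Suc_shift del: sum.lessThan_Suc)
  with assms show ?thesis
    unfolding sums_def by (subst filterlim_sequentially_Suc[symmetric]) simp
qed

lemma nm_sums_diff_le:
  assumes "f sums s" "0 \<le> C" "\<And>i. i \<ge> k \<Longrightarrow> nm (f i) \<le> C"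
  shows "nm (s - sum f {..<k}) \<le> C"
proof (rule nm_limit_le)
  show "(\<lambda>n. sum f {..<n} - sum f {..<k}) \<longlonglongrightarrow> s - sum f {..<k}"
    using tendsto_add_nm[OF assms(1)[unfolded sums_def] tendsto_const[of "- sum f {..<k}"]] by simp
  fix n assume "k \<le> n"
  then have "sum f {..<n} - sum f {..<k} = sum f {k..<n}"
    by (metis add_diff_cancel_left' lessThan_atLeast0 sum.atLeastLessThan_concat zero_le)
  then show "nm (sum f {..<n} - sum f {..<k}) \<le> C"
    using assms by (auto intro: nm_sum_le)
qed

text \<open>Partial products of absolute value 1 make each step as large as \<open>f n - 1\<close>,
  and they keep the limit away from 0. Serves both for the constant B and for the product in the
  period.\<close>

lemma tendsto_prod_unit:
  assumes "\<And>n. nm (f n) = 1" "(\<lambda>n. nm (f n - 1)) \<longlonglongrightarrow> 0"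
  shows "\<exists>L. (\<lambda>n. \<Prod>i<n. f i) \<longlonglongrightarrow> L \<and> nm L = 1"
proof -
  have one: "nm (\<Prod>i<n. f i) = 1" for n
    using assms(1) by (simp add: nm_prod)
  have "nm ((\<Prod>i<Suc n. f i) - (\<Prod>i<n. f i)) = nm (f n - 1)" for n
  proof -
    have "(\<Prod>i<Suc n. f i) - (\<Prod>i<n. f i) = (\<Prod>i<n. f i) * (f n - 1)"
      by (simp add: algebra_simps)
    then show ?thesis by (simp only: nm_mult one mult_1)
  qed
  then have "convergent (\<lambda>n. \<Prod>i<n. f i)"
    using assms(2) by (intro convergent_if_steps) (simp del: prod.lessThan_Suc)
  then obtain L where L: "(\<lambda>n. \<Prod>i<n. f i) \<longlonglongrightarrow> L" by (auto simp: convergent_def)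
  from tendsto_nm[OF L] have "nm L = 1"
    unfolding one by (simp add: LIMSEQ_const_iff)
  with L show ?thesis by blast
qed

lemma prodinf_eq_limit:
  assumes "(\<lambda>n. \<Prod>i<n. f i) \<longlonglongrightarrow> L" "L \<noteq> (0::'c)"
  shows "convergent_prod f" "prodinf f = L"
proof -
  have "(\<lambda>n. \<Prod>i\<le>n. f i) \<longlonglongrightarrow> L"
    using LIMSEQ_Suc[OF assms(1)] by (simp only: lessThan_Suc_atMost)
  then have raw: "raw_has_prod f 0 L"
    using assms(2) by (simp add: raw_has_prod_def)
  then show "convergent_prod f" by (auto simp: convergent_prod_def)
  have "p = L" if p: "f has_prod p" for p
    using p unfolding has_prod_def
  proof (elim disjE exE conjE)
    assume "raw_has_prod f 0 p"
    with raw show "p = L" by (auto simp: raw_has_prod_def intro: LIMSEQ_unique)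
  next
    \<comment> \<open>The second case of \<open>has_prod\<close> admits a zero factor and assigns
      the value 0; it would force the limit of the partial products to be 0.\<close>
    fix i assume "f i = 0"
    have "eventually (\<lambda>n. (\<Prod>i\<le>n. f i) = 0) sequentially"
      using eventually_ge_at_top[of i] by eventually_elim (use \<open>f i = 0\<close> in auto)
    then have "(\<lambda>n. \<Prod>i\<le>n. f i) \<longlonglongrightarrow> 0" by (rule tendsto_eventually)
    with raw assms(2) show "p = L" by (auto simp: raw_has_prod_def dest: LIMSEQ_unique)
  qed
  then show "prodinf f = L"
    unfolding prodinf_def using raw by (intro the_equality) (auto simp: has_prod_def)
qed

end

section \<open>Numerators of the exponential coefficients\<close>

locale frobenius_ultrametric_field = ultrametric_field nm
  for nm :: "'c::{field, complete_space} \<Rightarrow> real" +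
  fixes q :: nat
  assumes q_ge_2: "2 \<le> q"
    and frob_add: "(u + v :: 'c) ^ q = u ^ q + v ^ q"
begin

lemma q_pos [simp]: "0 < q"
  using q_ge_2 by simp

lemma frob_zero: "(0 :: 'c) ^ (q ^ i) = 0"
  by (simp add: zero_power)

lemma frob_power_add: "(u + v :: 'c) ^ (q ^ i) = u ^ (q ^ i) + v ^ (q ^ i)"
  by (induction i) (simp_all add: power_mult frob_add mult.commute[of q])

lemma frob_power_minus: "(- u :: 'c) ^ (q ^ i) = - (u ^ (q ^ i))"
  using frob_power_add[of u "- u" i] by (simp add: frob_zero eq_neg_iff_add_eq_0 add.commute)

lemma frob_power_diff: "(u - v :: 'c) ^ (q ^ i) = u ^ (q ^ i) - v ^ (q ^ i)"
  using frob_power_add[of u "- v" i] by (simp add: frob_power_minus)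

lemma frob_diff: "(u - v :: 'c) ^ q = u ^ q - v ^ q"
  using frob_power_diff[of u v 1] by simp

lemma frob_power_sum: "(sum f S :: 'c) ^ (q ^ i) = (\<Sum>k\<in>S. f k ^ (q ^ i))"
  by (induction S rule: infinite_finite_induct) (auto simp: frob_power_add frob_zero)

lemma sums_frob_power: "f sums (s :: 'c) \<Longrightarrow> (\<lambda>n. f n ^ (q ^ k)) sums s ^ (q ^ k)"
  unfolding sums_def by (simp add: tendsto_power_nm flip: frob_power_sum)

end

text \<open>\<open>z\<close> and \<open>t\<close> are the images of zeta and t in the complete
  field, and \<open>\<beta>\<close> is 1/|T|. Thus t reduces to \<open>z ^ q\<close>, which stays at
  distance 1 from \<open>z\<close>.\<close>

locale conjugate_places = frobenius_ultrametric_field nm q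
  for nm :: "'c::{field, complete_space} \<Rightarrow> real" and q +
  fixes z t :: 'c and \<beta> :: real
  assumes z_period: "z ^ (q ^ 2) = z"
    and nm_z_le: "nm z \<le> 1"
    and nm_z_conj: "nm (z ^ q - z) = 1"
    and nm_t: "nm (t - z ^ q) = \<beta>"
    and beta: "0 < \<beta>" "\<beta> < 1"
begin

lemma z_power: "z ^ (q ^ k) = (if even k then z else z ^ q)"
proof (induction k rule: induct_nat_012)
  case (ge2 k)
  have "z ^ (q ^ Suc (Suc k)) = (z ^ (q ^ 2)) ^ (q ^ k)"
    by (simp add: power_mult[symmetric] power_add[symmetric])
  with ge2 show ?case by (simp add: z_period)
qed auto

lemma z_power_cong: "even (i + k) \<Longrightarrow> z ^ (q ^ i) = z ^ (q ^ k)"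
  by (simp add: z_power)

lemma nm_t_z: "nm (t - z) = 1"
  using nm_add_eq[of "t - z ^ q" "z ^ q - z"] nm_z_conj nm_t beta by (simp add: add.commute)

text \<open>\<open>z ^ (q ^ k)\<close> depends only on the parity of k, so the difference is the
  \<open>q ^ i\<close>-th power of t - z or of t - \<open>z ^ q\<close>.\<close>

lemma nm_t_power_z: "nm (t ^ (q ^ i) - z ^ (q ^ k)) = (if even (i + k) then 1 else \<beta> ^ (q ^ i))"
proof (cases "even (i + k)")
  case True
  then have "t ^ (q ^ i) - z ^ (q ^ k) = (t - z) ^ (q ^ i)"
    using z_power_cong[of k i] by (simp add: frob_power_diff add.commute)
  with True show ?thesis by (simp add: nm_t_z)
next
  case False
  then have "z ^ (q ^ k) = z ^ (q ^ Suc i)"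
    by (intro z_power_cong) auto
  then have "t ^ (q ^ i) - z ^ (q ^ k) = (t - z ^ q) ^ (q ^ i)"
    by (simp add: frob_power_diff power_mult)
  with False show ?thesis by (simp add: nm_t)
qed

lemma power_q_strict_mono: "i < j \<Longrightarrow> q ^ i < q ^ j"
  using q_ge_2 by (intro power_strict_increasing) auto

lemma beta_power_less: "m < n \<Longrightarrow> \<beta> ^ n < \<beta> ^ m"
  using beta by (intro power_strict_decreasing) auto

lemma beta_power_le_one: "\<beta> ^ n \<le> 1"
  using beta by (intro power_le_one) auto

lemma beta_power_less_one: "0 < n \<Longrightarrow> \<beta> ^ n < 1"
  using beta_power_less[of 0 n] by simp

text \<open>Both powers are compared with \<open>z ^ (q ^ Suc i)\<close>, the conjugate close to
  \<open>t ^ (q ^ i)\<close>. The later power is either much closer to it or at distance 1, so no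
  cancellation occurs.\<close>

lemma nm_t_power_diff:
  assumes "i < j"
  shows "nm (t ^ (q ^ i) - t ^ (q ^ j)) = (if even (i + j) then \<beta> ^ (q ^ i) else 1)"
proof -
  define a b where "a = t ^ (q ^ i) - z ^ (q ^ Suc i)" and "b = t ^ (q ^ j) - z ^ (q ^ Suc i)"
  have *: "t ^ (q ^ i) - t ^ (q ^ j) = a - b" "t ^ (q ^ j) - t ^ (q ^ i) = b - a"
    by (auto simp: a_def b_def)
  have a: "nm a = \<beta> ^ (q ^ i)"
    unfolding a_def by (subst nm_t_power_z) auto
  show ?thesis
  proof (cases "even (i + j)")
    case True
    then have "nm b = \<beta> ^ (q ^ j)"
      unfolding b_def by (subst nm_t_power_z) auto
    then have "nm b < nm a"
      using a assms by (auto intro!: beta_power_less power_q_strict_mono)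
    then show ?thesis using True a by (simp add: * nm_diff_eq)
  next
    case False
    then have "nm b = 1"
      unfolding b_def by (subst nm_t_power_z) auto
    then have "nm a < nm b"
      using a by (simp add: beta_power_less_one)
    then show ?thesis using False \<open>nm b = 1\<close> 
      by (subst nm_diff_commute) (simp add: * nm_diff_eq)
  qed
qed

lemma nm_t_power_diff':
  assumes "j < i"
  shows "nm (t ^ (q ^ i) - t ^ (q ^ j)) = (if even (i + j) then \<beta> ^ (q ^ j) else 1)"
  using nm_t_power_diff[OF assms] by (simp add: nm_diff_commute add.commute)

lemma t_power_eq_iff [simp]: "t ^ (q ^ i) = t ^ (q ^ j) \<longleftrightarrow> i = j"
proof -
  have "t ^ (q ^ i) \<noteq> t ^ (q ^ j)" if "i < j" for i j
  proof
    assume "t ^ (q ^ i) = t ^ (q ^ j)"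
    then have "nm (t ^ (q ^ i) - t ^ (q ^ j)) = 0" by simp
    then show False using nm_t_power_diff[OF that] beta by (simp split: if_splits)
  qed
  then show ?thesis by (metis linorder_neqE_nat)
qed

lemma t_power_neq_z [simp]: "t ^ (q ^ i) \<noteq> z ^ (q ^ k)"
proof
  assume "t ^ (q ^ i) = z ^ (q ^ k)"
  then have "nm (t ^ (q ^ i) - z ^ (q ^ k)) = 0" by simp
  then show False using beta by (simp add: nm_t_power_z split: if_splits)
qed

text \<open>The coefficients of both exponentials are \<open>exp_num w i * \<eta> ^ (q ^ i - 1)\<close> with
  \<open>\<eta> ^ (q - 1) = - (t - w)\<close>, where \<open>w = \<zeta>\<^sup>q\<close> for \<open>\<Psi>\<close> and \<open>w = \<zeta>\<close> for \<open>\<Psi>\<^sup>\<sigma>\<close>.\<close>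

definition exp_num :: "'c \<Rightarrow> nat \<Rightarrow> 'c" where
  "exp_num w i = (\<Prod>j<i. (t ^ (q ^ i) - w ^ (q ^ j)) / (t ^ (q ^ i) - t ^ (q ^ j)))"

lemma exp_num_0 [simp]: "exp_num w 0 = 1"
  by (simp add: exp_num_def)

text \<open>Numerator and denominator of a factor are small for the same j, those with i + j even,
  with exponents \<open>q ^ i\<close> and \<open>q ^ j\<close>.\<close>

lemma nm_exp_num_conj:
  "nm (exp_num (z ^ q) i) = (\<Prod>j<i. if even (i + j) then \<beta> ^ (q ^ i - q ^ j) else 1)"
  unfolding exp_num_def nm_prod
proof (rule prod.cong[OF refl])
  fix j assume "j \<in> {..<i}"
  then have j: "j < i" by simp
  have *: "(z ^ q) ^ (q ^ j) = z ^ (q ^ Suc j)"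
    by (simp add: power_mult)
  show "nm ((t ^ q ^ i - (z ^ q) ^ q ^ j) / (t ^ q ^ i - t ^ q ^ j)) =
        (if even (i + j) then \<beta> ^ (q ^ i - q ^ j) else 1)"
    unfolding * nm_divide nm_t_power_z nm_t_power_diff'[OF j]
    using beta power_q_strict_mono[OF j] by (auto simp: power_diff)
qed

text \<open>The numerators involve the conjugates with exponents 0, ..., i - 1 on one side and 1,
  ..., i on the other; only the two end factors survive in the quotient.\<close>

lemma exp_num_z: "exp_num z i = exp_num (z ^ q) i * ((t ^ (q ^ i) - z) / (t ^ (q ^ i) - z ^ (q ^ i)))"
proof -
  have *: "(z ^ q) ^ (q ^ j) = z ^ (q ^ Suc j)" for j
    by (simp add: power_mult)
  define a b where "a = (\<Prod>j<i. t ^ (q ^ i) - z ^ (q ^ j))"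
    and "b = (\<Prod>j<i. t ^ (q ^ i) - (z ^ q) ^ (q ^ j))"
  have "a * (t ^ (q ^ i) - z ^ (q ^ i)) = (\<Prod>j<Suc i. t ^ (q ^ i) - z ^ (q ^ j))"
    by (simp add: a_def)
  also have "\<dots> = (t ^ (q ^ i) - z) * b"
    unfolding * b_def by (subst prod.lessThan_Suc_shift) simp
  finally have "a = (t ^ (q ^ i) - z) * b / (t ^ (q ^ i) - z ^ (q ^ i))"
    by (simp add: eq_divide_eq)
  then show ?thesis
    by (simp add: exp_num_def prod_dividef mult.commute flip: a_def b_def)
qed

lemma nm_exp_num_z:
  "nm (exp_num z i) = nm (exp_num (z ^ q) i) * (if even i then 1 else \<beta> ^ (q ^ i))"
proof -
  have "nm (t ^ (q ^ i) - z) = (if even i then 1 else \<beta> ^ (q ^ i))"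
    using nm_t_power_z[of i 0] by simp
  then show ?thesis by (simp add: exp_num_z nm_t_power_z)
qed

lemma prod_alternating:
  "(\<Prod>j<n. if even (e + j) then c else 1) = (c :: real) ^ (if even e then Suc n div 2 else n div 2)"
proof (induction n)
  case (Suc n)
  then show ?case
    by (cases "even e"; cases "even n") (auto elim!: evenE oddE)
qed simp

text \<open>There are i div 2 indices j < i with i + j even. They satisfy j \<le> i - 2, so each
  contributes an exponent \<open>q^i - q^j\<close> of at least \<open>q^(i-1)\<close>.\<close>

lemma nm_exp_num_conj_le: "nm (exp_num (z ^ q) i) \<le> \<beta> ^ (q ^ (i - 1) * (i div 2))"
proof -
  have "nm (exp_num (z ^ q) i) \<le> (\<Prod>j<i. if even (i + j) then \<beta> ^ (q ^ (i - 1)) else 1)"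
    unfolding nm_exp_num_conj
  proof (intro prod_mono conjI)
    fix j assume "j \<in> {..<i}"
    then have j: "j < i" by simp
    show "0 \<le> (if even (i + j) then \<beta> ^ (q ^ i - q ^ j) else 1)"
      using beta by simp
    obtain k where k: "i = Suc k" using j by (cases i) auto
    have "q ^ k \<le> q ^ i - q ^ j" if "even (i + j)"
    proof -
      have "j \<noteq> k" using that k by auto
      then have "j \<le> k - 1" "0 < k" using j k by auto
      have "q ^ j \<le> q ^ k" using j k q_ge_2 by (intro power_increasing) auto
      moreover have "2 * q ^ k \<le> q ^ i" using k q_ge_2 by simp
      ultimately show ?thesis by linarith
    qed
    then show "(if even (i + j) then \<beta> ^ (q ^ i - q ^ j) else 1) \<le>
          (if even (i + j) then \<beta> ^ (q ^ (i - 1)) else 1)"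
      using beta k by (auto intro!: power_decreasing)
  qed
  also have "\<dots> = \<beta> ^ (q ^ (i - 1) * (i div 2))"
    unfolding prod_alternating by (cases "even i") (auto simp: power_mult)
  finally show ?thesis .
qed

lemma nm_exp_num_conj_le_one: "nm (exp_num (z ^ q) i) \<le> 1"
  using nm_exp_num_conj_le[of i] beta_power_le_one order_trans by blast

lemma nm_exp_num_conj_less_one: "2 \<le> i \<Longrightarrow> nm (exp_num (z ^ q) i) \<le> \<beta>"
proof (rule order_trans[OF nm_exp_num_conj_le])
  assume i: "2 \<le> i"
  then have "1 \<le> q ^ (i - 1) * (i div 2)" using q_ge_2 by (simp add: Suc_le_eq div_greater_zero_iff)
  then have "\<beta> ^ (q ^ (i - 1) * (i div 2)) \<le> \<beta> ^ 1"
    using beta by (intro power_decreasing) auto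
  then show "\<beta> ^ (q ^ (i - 1) * (i div 2)) \<le> \<beta>" by simp
qed

lemma nm_exp_num_z_le: "nm (exp_num z i) \<le> nm (exp_num (z ^ q) i)"
  unfolding nm_exp_num_z using beta_power_le_one by (auto intro: mult_left_le)

text \<open>This makes the exponentials entire. With the exponent \<open>q^(i-1)\<close> factored
  out the base is \<open>\<beta>^(i div 2) * r^q\<close>, which tends to 0 for every radius
  r.\<close>

lemma exp_num_conj_decay: "(\<lambda>i. nm (exp_num (z ^ q) i) * r ^ (q ^ i)) \<longlonglongrightarrow> 0" if r: "0 \<le> r"
proof -
  have "(\<lambda>i. \<beta> ^ (i div 2)) \<longlonglongrightarrow> 0"
  proof -
    have "filterlim (\<lambda>i::nat. i div 2) sequentially sequentially"
      unfolding filterlim_at_top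
    proof
      fix n :: nat
      show "\<forall>\<^sub>F i in sequentially. n \<le> i div 2"
        using eventually_ge_at_top[of "2 * n"] by eventually_elim auto
    qed
    moreover have "(\<lambda>i. \<beta> ^ i) \<longlonglongrightarrow> 0" using beta by (intro LIMSEQ_power_zero) auto
    ultimately show ?thesis by (rule filterlim_compose[rotated])
  qed
  then have "(\<lambda>i. \<beta> ^ (i div 2) * r ^ q) \<longlonglongrightarrow> 0 * r ^ q"
    by (intro tendsto_intros)
  then have ev: "\<forall>\<^sub>F i in sequentially. \<beta> ^ (i div 2) * r ^ q < 1 / 2"
    by (rule order_tendstoD) auto
  have lim: "(\<lambda>i. (1 / 2 :: real) ^ (i - 1)) \<longlonglongrightarrow> 0"
    by (subst filterlim_sequentially_Suc[symmetric]) (simp add: LIMSEQ_power_zero)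
  show ?thesis
  proof (rule tendsto_sandwich[OF _ _ tendsto_const lim])
    show "\<forall>\<^sub>F i in sequentially. 0 \<le> nm (exp_num (z ^ q) i) * r ^ (q ^ i)"
      using r by simp
    show "\<forall>\<^sub>F i in sequentially. nm (exp_num (z ^ q) i) * r ^ (q ^ i) \<le> (1 / 2) ^ (i - 1)"
      using ev eventually_ge_at_top[of 1]
    proof eventually_elim
      case (elim i)
      then have qi: "q ^ i = q ^ (i - 1) * q" by (cases i) auto
      have "nm (exp_num (z ^ q) i) * r ^ (q ^ i) \<le> \<beta> ^ (q ^ (i - 1) * (i div 2)) * r ^ (q ^ i)"
        using r by (intro mult_right_mono nm_exp_num_conj_le) auto
      also have "\<dots> = (\<beta> ^ (i div 2) * r ^ q) ^ (q ^ (i - 1))"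
        by (simp add: qi power_mult_distrib power_mult[symmetric] mult.commute)
      also have "\<dots> \<le> (1 / 2) ^ (q ^ (i - 1))"
        using elim r beta by (intro power_mono) auto
      also have "\<dots> \<le> (1 / 2) ^ (i - 1)"
        using q_ge_2 self_le_ge2_pow[of q "i - 1"] by (intro power_decreasing) auto
      finally show ?case .
    qed
  qed
qed

lemma exp_num_decay:
  assumes "w = z \<or> w = z ^ q" "0 \<le> r"
  shows "(\<lambda>i. nm (exp_num w i) * r ^ (q ^ i)) \<longlonglongrightarrow> 0"
proof (rule tendsto_sandwich[OF _ _ tendsto_const exp_num_conj_decay[OF assms(2)]])
  show "\<forall>\<^sub>F i in sequentially. nm (exp_num w i) * r ^ (q ^ i) \<le> nm (exp_num (z ^ q) i) * r ^ (q ^ i)"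
    using assms nm_exp_num_z_le by (intro always_eventually) (auto intro!: mult_right_mono)
qed (use assms in auto)

end

section \<open>Zeros of the exponentials from Lagrange interpolation\<close>

text \<open>The sum is the coefficient of \<open>X\<^sup>|\<^sup>S\<^sup>|\<^sup>-\<^sup>1\<close> in the Lagrange interpolant of \<open>P\<close> at the points \<open>a i\<close>,
  which is \<open>P\<close> itself.\<close>

lemma lagrange_sum_eq_0:
  fixes a :: "'i \<Rightarrow> 'a::field"
  assumes fin: "finite S" and inj: "inj_on a S" and deg: "Polynomial.degree P + 1 < card S"
  shows "(\<Sum>i\<in>S. poly P (a i) / (\<Prod>j\<in>S - {i}. a i - a j)) = 0"
proof -
  define c where "c i = poly P (a i) / (\<Prod>j\<in>S - {i}. a i - a j)" for i
  define L where "L i = (\<Prod>j\<in>S - {i}. [:- a j, 1:])" for i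
  define Q where "Q = (\<Sum>i\<in>S. Polynomial.smult (c i) (L i))"
  have card: "card (S - {i}) = card S - 1" if "i \<in> S" for i
    using that fin by simp
  have degL: "Polynomial.degree (L i) = card S - 1" if "i \<in> S" for i
    unfolding L_def using card[OF that] by (subst degree_prod_eq_sum_degree) auto
  have lead: "poly.coeff (L i) (card S - 1) = 1" if "i \<in> S" for i
    using lead_coeff_prod[of "\<lambda>j. [:- a j, 1:]" "S - {i}"] degL[OF that] by (simp add: L_def)
  have "Q = P"
  proof (rule poly_eqI_degree)
    fix u assume "u \<in> a ` S"
    then obtain k where k: "k \<in> S" "u = a k" by auto
    have "poly Q u = (\<Sum>i\<in>S. c i * poly (L i) (a k))"
      by (simp add: Q_def poly_sum k)
    also have "\<dots> = (\<Sum>i\<in>S. if i = k then c k * poly (L k) (a k) else 0)"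
    proof (rule sum.cong[OF refl])
      fix i assume "i \<in> S"
      show "c i * poly (L i) (a k) = (if i = k then c k * poly (L k) (a k) else 0)"
        using k fin by (auto simp: L_def poly_prod)
    qed
    also have "\<dots> = c k * poly (L k) (a k)"
      using k fin by simp
    also have "poly (L k) (a k) = (\<Prod>j\<in>S - {k}. a k - a j)"
      by (simp add: L_def poly_prod)
    also have "c k * \<dots> = poly P (a k)"
      using k inj fin by (auto simp: c_def inj_on_def)
    finally show "poly Q u = poly P u" using k by simp
  next
    have "Polynomial.degree Q \<le> card S - 1"
      unfolding Q_def using degL by (intro degree_sum_le fin) (metis degree_smult_le)
    then show "Polynomial.degree Q < card (a ` S)"
      using deg by (simp add: card_image inj)
    show "Polynomial.degree P < card (a ` S)"
      using deg by (simp add: card_image inj)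
  qed
  then have "poly.coeff Q (card S - 1) = 0"
    using deg by (simp add: coeff_eq_0)
  then show ?thesis
    using lead by (simp add: Q_def coeff_sum c_def)
qed

lemma prod_remove_split:
  fixes f :: "nat \<Rightarrow> 'a::comm_monoid_mult"
  assumes "i \<le> m"
  shows "(\<Prod>j\<in>{..m} - {i}. f j) = (\<Prod>j<i. f j) * (\<Prod>j<m - i. f (Suc (i + j)))"
proof -
  have eq: "{..m} - {i} = {..<i} \<union> {Suc i..<Suc m}" using assms by auto
  have "(\<Prod>j\<in>{..m} - {i}. f j) = (\<Prod>j<i. f j) * (\<Prod>j\<in>{Suc i..<Suc m}. f j)"
    unfolding eq by (rule prod.union_disjoint) auto
  also have "(\<Prod>j\<in>{Suc i..<Suc m}. f j) = (\<Prod>j<m - i. f (Suc (i + j)))"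
    by (subst prod.atLeastLessThan_shift_0) (simp add: atLeast0LessThan)
  finally show ?thesis .
qed

context conjugate_places
begin

text \<open>Its \<open>q\<^sup>i\<close>-th power is the part \<open>j > i\<close> of the denominator of the \<open>i\<close>-th Lagrange term,
  just as \<open>exp_num\<close> is the part \<open>j < i\<close>.\<close>

definition tail_prod :: "nat \<Rightarrow> 'c" where
  "tail_prod k = (\<Prod>j<k. (t - z ^ (q ^ j)) / (t - t ^ (q ^ Suc j)))"

text \<open>Numerator and denominator differ by \<open>t^(q^(j+1)) - z^(q^j)\<close>, which is tiny;
  dividing by a denominator possibly as small as \<beta> still leaves a bound that tends to
  0.\<close>

lemma tail_prod_factor:
  defines "f \<equiv> \<lambda>j. (t - z ^ (q ^ j)) / (t - t ^ (q ^ Suc j))"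
  shows "nm (f j) = 1" "nm (f j - 1) \<le> \<beta> ^ j"
proof -
  have num: "nm (t - z ^ (q ^ j)) = (if even j then 1 else \<beta>)"
    using nm_t_power_z[of 0 j] by simp
  have den: "nm (t - t ^ (q ^ Suc j)) = (if even j then 1 else \<beta>)"
    using nm_t_power_diff[of 0 "Suc j"] by simp
  show "nm (f j) = 1"
    unfolding f_def nm_divide num den using beta by simp
  have nz: "t - t ^ (q ^ Suc j) \<noteq> 0"
    using t_power_eq_iff[of 0 "Suc j"] by simp
  then have "f j - 1 = (t ^ (q ^ Suc j) - z ^ (q ^ j)) / (t - t ^ (q ^ Suc j))"
    unfolding f_def by (subst divide_diff_eq_iff) (simp_all del: power_Suc)
  then have "nm (f j - 1) = \<beta> ^ (q ^ Suc j) / (if even j then 1 else \<beta>)"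
    by (simp only: nm_divide den) (subst nm_t_power_z, simp)
  also have "\<dots> \<le> \<beta> ^ (q ^ Suc j) / \<beta>"
    using beta by (auto simp: divide_le_cancel field_simps mult_left_le)
  also have "\<dots> \<le> \<beta> ^ Suc j / \<beta>"
    using beta q_ge_2 self_le_ge2_pow[of q "Suc j"]
    by (intro divide_right_mono power_decreasing) auto
  also have "\<dots> = \<beta> ^ j"
    using beta by simp
  finally show "nm (f j - 1) \<le> \<beta> ^ j" .
qed

lemma nm_tail_prod: "nm (tail_prod k) = 1"
  by (simp only: tail_prod_def nm_prod tail_prod_factor(1) prod.neutral_const)

lemma tail_prod_convergent: "\<exists>B. tail_prod \<longlonglongrightarrow> B \<and> nm B = 1"
proof -
  have "(\<lambda>n. nm ((t - z ^ (q ^ n)) / (t - t ^ (q ^ Suc n)) - 1)) \<longlonglongrightarrow> 0"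
    using tail_prod_factor(2) beta
    by (intro tendsto_sandwich[OF _ _ tendsto_const LIMSEQ_power_zero[of \<beta>]] always_eventually allI)
      (simp_all del: nm_divide power_Suc)
  then show ?thesis
    unfolding tail_prod_def[abs_def] by (intro tendsto_prod_unit tail_prod_factor(1))
qed

text \<open>The \<open>q ^ i\<close>-th power moves the j-th tail factor to index i + j. The
  numerators of both parts then join into a product over all k < m that no longer remembers the
  split at i.\<close>

lemma exp_num_tail_prod:
  assumes "i \<le> m"
  shows "exp_num z i * tail_prod (m - i) ^ (q ^ i) =
    (\<Prod>k<m. t ^ (q ^ i) - z ^ (q ^ k)) / (\<Prod>j\<in>{..m} - {i}. t ^ (q ^ i) - t ^ (q ^ j))"
proof -
  have "tail_prod (m - i) ^ (q ^ i) =
      (\<Prod>j<m - i. (t ^ (q ^ i) - z ^ (q ^ (i + j))) / (t ^ (q ^ i) - t ^ (q ^ Suc (i + j))))"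
    unfolding tail_prod_def prod_power_distrib
    by (intro prod.cong refl)
      (simp add: power_divide frob_power_diff power_add mult.commute[of "q ^ i"] mult.assoc flip: power_mult)
  moreover have "(\<Prod>k<m. v k) = (\<Prod>j<i. v j) * (\<Prod>j<m - i. v (i + j))" for v :: "nat \<Rightarrow> 'c"
  proof -
    have "prod v {i..<m} = (\<Prod>j<m - i. v (i + j))"
      by (subst prod.atLeastLessThan_shift_0) (simp add: atLeast0LessThan)
    then show ?thesis
      using assms prod.atLeastLessThan_concat[of 0 i m v] by (simp add: atLeast0LessThan)
  qed
  ultimately show ?thesis
    unfolding prod_remove_split[OF assms] exp_num_def by (simp add: prod_dividef del: power_Suc)
qed

lemma prod_z_power:
  "(\<Prod>k<2 * l. u - z ^ (q ^ k)) = ((u - z) * (u - z ^ q)) ^ l"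
proof (induction l)
  case (Suc l)
  have "{..<2 * Suc l} = insert (2 * l + 1) (insert (2 * l) {..<2 * l})" by auto
  then show ?case using Suc by (simp add: z_power mult_ac)
qed simp

text \<open>This is pi(X), as a polynomial over the complete field.\<close>

definition places_poly :: "'c poly" where
  "places_poly = [:- z, 1:] * [:- (z ^ q), 1:]"

lemma poly_places_poly: "poly places_poly u = (u - z) * (u - z ^ q)"
  by (simp add: places_poly_def algebra_simps)

lemma degree_places_poly_power: "Polynomial.degree (places_poly ^ n) \<le> 2 * n"
proof -
  have "Polynomial.degree places_poly \<le> 2"
    unfolding places_poly_def by (rule order_trans[OF degree_mult_le]) simp
  then show ?thesis
    by (meson degree_power_le le_trans mult_le_mono1)
qed

lemma inj_on_t_power: "inj_on (\<lambda>i. t ^ (q ^ i)) S"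
  by (auto simp: inj_on_def)

text \<open>For odd m the completed numerator is pi^n times X - z. By \<open>exp_num_z\<close>,
  passing to \<open>z ^ q\<close> trades X - z for \<open>X - z^(q^i)\<close>, and the power of 1/(t
  - z) removes the latter. The degree 2n is just low enough for 2n + 2 points.\<close>

lemma sum_exp_num_conj_eq_0:
  assumes m: "m = 2 * n + 1"
  shows "(\<Sum>i\<le>m. exp_num (z ^ q) i * (1 / (t - z)) ^ (q ^ i) * tail_prod (m - i) ^ (q ^ i)) = 0"
proof -
  have "exp_num (z ^ q) i * (1 / (t - z)) ^ (q ^ i) * tail_prod (m - i) ^ (q ^ i) =
      poly (places_poly ^ n) (t ^ (q ^ i)) / (\<Prod>j\<in>{..m} - {i}. t ^ (q ^ i) - t ^ (q ^ j))"
    if "i \<in> {..m}" for i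
  proof -
    define v where "v k = t ^ (q ^ i) - z ^ (q ^ k)" for k
    define d where "d = (\<Prod>j\<in>{..m} - {i}. t ^ (q ^ i) - t ^ (q ^ j))"
    have nz: "v k \<noteq> 0" for k
      by (simp add: v_def)
    have v0: "v 0 = t ^ (q ^ i) - z" by (simp add: v_def)
    have pr: "(\<Prod>k<m. v k) = ((t ^ q ^ i - z) * (t ^ q ^ i - z ^ q)) ^ n * v 0"
      unfolding m v_def using prod_z_power[of "t ^ (q ^ i)" n] by (simp add: z_power)
    have 1: "(1 / (t - z)) ^ (q ^ i) = 1 / v i"
      by (simp add: power_divide frob_power_diff v_def)
    have 2: "exp_num z i = exp_num (z ^ q) i * (v 0 / v i)"
      using exp_num_z[of i] by (simp add: v_def)
    have "exp_num (z ^ q) i * (1 / v i) * tail_prod (m - i) ^ (q ^ i) * v 0 =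
        exp_num z i * tail_prod (m - i) ^ (q ^ i)"
      by (simp add: 2)
    also have "\<dots> = (\<Prod>k<m. v k) / d"
      using exp_num_tail_prod[of i m] that by (simp add: v_def d_def)
    finally have "exp_num (z ^ q) i * (1 / v i) * tail_prod (m - i) ^ (q ^ i) =
        ((t ^ q ^ i - z) * (t ^ q ^ i - z ^ q)) ^ n / d"
      unfolding pr using nz[of 0] mult_right_cancel[OF nz[of 0]] by (metis times_divide_eq_left)
    then show ?thesis
      unfolding 1 d_def by (simp add: poly_power poly_places_poly)
  qed
  then have "(\<Sum>i\<le>m. exp_num (z ^ q) i * (1 / (t - z)) ^ (q ^ i) * tail_prod (m - i) ^ (q ^ i)) =
      (\<Sum>i\<le>m. poly (places_poly ^ n) (t ^ (q ^ i)) / (\<Prod>j\<in>{..m} - {i}. t ^ (q ^ i) - t ^ (q ^ j)))"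
    by (rule sum.cong[OF refl])
  also have "\<dots> = 0"
    using degree_places_poly_power[of n] m
    by (intro lagrange_sum_eq_0[OF _ inj_on_t_power]) auto
  finally show ?thesis .
qed

text \<open>For even m the completed numerator is pi^(n+1). Frobenius permutes the roots of pi, so
  the power of 1/pi(t) cancels one factor pi. With 2n + 3 points there is room for one more factor
  X, which is why both 1 and t lead to zeros.\<close>

lemma sum_exp_num_eq_0:
  assumes m: "m = 2 * n + 2" and e: "e \<le> (1::nat)"
  shows "(\<Sum>i\<le>m. exp_num z i * (t ^ e / ((t - z) * (t - z ^ q))) ^ (q ^ i) * tail_prod (m - i) ^ (q ^ i)) = 0"
proof -
  have "exp_num z i * (t ^ e / ((t - z) * (t - z ^ q))) ^ (q ^ i) * tail_prod (m - i) ^ (q ^ i) =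
      poly (places_poly ^ n * Polynomial.monom 1 e) (t ^ (q ^ i)) / (\<Prod>j\<in>{..m} - {i}. t ^ (q ^ i) - t ^ (q ^ j))"
    if "i \<in> {..m}" for i
  proof -
    define s where "s = t ^ (q ^ i)"
    define d where "d = (\<Prod>j\<in>{..m} - {i}. t ^ (q ^ i) - t ^ (q ^ j))"
    have nz: "(s - z) * (s - z ^ q) \<noteq> 0"
      using t_power_neq_z[of i 0] t_power_neq_z[of i 1] by (simp add: s_def)
    have pr: "(\<Prod>k<m. s - z ^ (q ^ k)) = ((s - z) * (s - z ^ q)) ^ Suc n"
      unfolding m using prod_z_power[of s "Suc n"] by simp
    have "((t - z) * (t - z ^ q)) ^ (q ^ i) = (s - z ^ (q ^ i)) * (s - z ^ (q ^ Suc i))"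
      by (simp add: s_def power_mult_distrib frob_power_diff power_mult)
    also have "\<dots> = (s - z) * (s - z ^ q)"
      by (cases "even i") (simp_all add: z_power del: power_Suc)
    finally have "(t ^ e / ((t - z) * (t - z ^ q))) ^ (q ^ i) = s ^ e / ((s - z) * (s - z ^ q))"
      by (simp add: power_divide s_def mult.commute flip: power_mult)
    then have "exp_num z i * (t ^ e / ((t - z) * (t - z ^ q))) ^ (q ^ i) * tail_prod (m - i) ^ (q ^ i) =
        (exp_num z i * tail_prod (m - i) ^ (q ^ i)) * (s ^ e / ((s - z) * (s - z ^ q)))"
      by simp
    also have "exp_num z i * tail_prod (m - i) ^ (q ^ i) = ((s - z) * (s - z ^ q)) ^ Suc n / d"
      using exp_num_tail_prod[of i m] that pr by (simp add: s_def d_def)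
    also have "\<dots> * (s ^ e / ((s - z) * (s - z ^ q))) = ((s - z) * (s - z ^ q)) ^ n * s ^ e / d"
      using nz by simp
    finally show ?thesis
      by (simp add: d_def s_def poly_power poly_places_poly poly_monom)
  qed
  then have "(\<Sum>i\<le>m. exp_num z i * (t ^ e / ((t - z) * (t - z ^ q))) ^ (q ^ i) * tail_prod (m - i) ^ (q ^ i)) =
      (\<Sum>i\<le>m. poly (places_poly ^ n * Polynomial.monom 1 e) (t ^ (q ^ i)) / (\<Prod>j\<in>{..m} - {i}. t ^ (q ^ i) - t ^ (q ^ j)))"
    by (rule sum.cong[OF refl])
  also have "\<dots> = 0"
  proof (intro lagrange_sum_eq_0[OF _ inj_on_t_power])
    have "Polynomial.degree (places_poly ^ n * Polynomial.monom 1 e) \<le> 2 * n + e"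
      by (rule order_trans[OF degree_mult_le]) (intro add_mono degree_places_poly_power degree_monom_le)
    then show "Polynomial.degree (places_poly ^ n * Polynomial.monom 1 e) + 1 < card {..m}"
      using m e by simp
  qed simp
  finally show ?thesis .
qed

text \<open>Additivity of Frobenius turns the error of a truncated sum into terms
  \<open>a i * (B - tail_prod (k - i)) ^ (q ^ i)\<close>. For i \<ge> N the factor
  \<open>a i\<close> is small; for i < N the index k - i is at least M, and \<open>tail_prod\<close>
  is already close to B.\<close>

lemma sums_0_of_truncations:
  assumes decay: "(\<lambda>i. nm (a i)) \<longlonglongrightarrow> 0"
    and B: "tail_prod \<longlonglongrightarrow> B" "nm B = 1"
    and zero: "\<And>n. (\<Sum>i\<le>m n. a i * tail_prod (m n - i) ^ (q ^ i)) = 0"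
    and m: "\<And>n. n \<le> m n"
  shows "(\<lambda>i. a i * B ^ (q ^ i)) sums 0"
proof -
  have "(\<lambda>i. a i * B ^ (q ^ i)) \<longlonglongrightarrow> 0"
    unfolding tendsto_iff_nm[of "\<lambda>i. a i * B ^ (q ^ i)"] using decay B(2) by simp
  then obtain s where s: "(\<lambda>i. a i * B ^ (q ^ i)) sums s"
    using summable_if_tendsto_0 by (auto simp: summable_def)
  obtain C where C: "0 < C" "\<And>i. nm (a i) \<le> C"
    using convergent_imp_Bseq[OF convergentI[OF decay]] by (auto elim!: BseqE)
  have "nm s \<le> e" if "0 < e" for e
  proof -
    obtain N where N: "\<And>i. i \<ge> N \<Longrightarrow> nm (a i) < e"
      using order_tendstoD(2)[OF decay \<open>0 < e\<close>] by (auto simp: eventually_sequentially)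
    have "(\<lambda>k. nm (tail_prod k - B)) \<longlonglongrightarrow> 0"
      using B(1) tendsto_iff_nm by blast
    then obtain M where M: "\<And>k. k \<ge> M \<Longrightarrow> nm (tail_prod k - B) < e / C"
      using order_tendstoD(2)[of _ 0 sequentially "e / C"] \<open>0 < e\<close> C(1)
      by (auto simp: eventually_sequentially)
    define k where "k = m (N + M)"
    have k: "N + M \<le> k" using m by (simp add: k_def)
    have "(\<Sum>i\<le>k. a i * B ^ (q ^ i)) = (\<Sum>i\<le>k. a i * B ^ (q ^ i)) - (\<Sum>i\<le>k. a i * tail_prod (k - i) ^ (q ^ i))"
      using zero[of "N + M"] by (simp add: k_def)
    also have "\<dots> = (\<Sum>i\<le>k. a i * (B - tail_prod (k - i)) ^ (q ^ i))"
      by (simp add: frob_power_diff right_diff_distrib sum_subtractf)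
    also have "nm \<dots> \<le> e"
    proof (rule nm_sum_le)
      fix i assume "i \<in> {..k}"
      have le1: "nm (B - tail_prod (k - i)) \<le> 1"
        using nm_diff_le[of B "tail_prod (k - i)"] B(2) nm_tail_prod by simp
      show "nm (a i * (B - tail_prod (k - i)) ^ (q ^ i)) \<le> e"
      proof (cases "N \<le> i")
        case True
        have "nm (a i) * nm (B - tail_prod (k - i)) ^ (q ^ i) \<le> nm (a i) * 1"
          using le1 by (intro mult_left_mono power_le_one) auto
        with N[OF True] show ?thesis by simp
      next
        case False
        have "nm (B - tail_prod (k - i)) ^ (q ^ i) \<le> nm (B - tail_prod (k - i)) ^ 1"
          using le1 by (intro power_decreasing) (auto simp: Suc_le_eq)
        also have "\<dots> \<le> e / C"
          using M[of "k - i"] k False by (simp add: nm_diff_commute less_imp_le)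
        finally have "nm (a i) * nm (B - tail_prod (k - i)) ^ (q ^ i) \<le> C * (e / C)"
          using C by (intro mult_mono) auto
        then show ?thesis using C(1) by simp
      qed
    qed (use \<open>0 < e\<close> in simp)
    finally have 1: "nm (\<Sum>i\<le>k. a i * B ^ (q ^ i)) \<le> e" .
    have "nm (s - (\<Sum>i<Suc k. a i * B ^ (q ^ i))) \<le> e"
    proof (rule nm_sums_diff_le[OF s])
      show "nm (a i * B ^ (q ^ i)) \<le> e" if "Suc k \<le> i" for i
        using N[of i] that k B(2) by simp
    qed (use \<open>0 < e\<close> in simp)
    with 1 show ?thesis
      using nm_add_le'[of "s - (\<Sum>i\<le>k. a i * B ^ (q ^ i))" e "\<Sum>i\<le>k. a i * B ^ (q ^ i)"]
      by (simp only: lessThan_Suc_atMost) simp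
  qed
  then have "nm s \<le> 0" by (rule field_le_epsilon) simp
  then have "s = 0" by (metis nm_eq_0_iff nm_nonneg order_antisym)
  with s show ?thesis by simp
qed

lemma exp_num_conj_zero:
  assumes "tail_prod \<longlonglongrightarrow> B" "nm B = 1"
  shows "(\<lambda>i. exp_num (z ^ q) i * (B / (t - z)) ^ (q ^ i)) sums 0"
proof -
  have "(\<lambda>i. nm (exp_num (z ^ q) i) * nm (1 / (t - z)) ^ (q ^ i)) \<longlonglongrightarrow> 0"
    by (rule exp_num_decay) auto
  then have "(\<lambda>i. exp_num (z ^ q) i * (1 / (t - z)) ^ (q ^ i) * B ^ (q ^ i)) sums 0"
    by (intro sums_0_of_truncations[where m = "\<lambda>n. 2 * n + 1"] assms sum_exp_num_conj_eq_0) auto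
  then show ?thesis by (simp add: power_divide mult.commute)
qed

lemma exp_num_zero:
  assumes "tail_prod \<longlonglongrightarrow> B" "nm B = 1" "e \<le> 1"
  shows "(\<lambda>i. exp_num z i * (t ^ e * (B / ((t - z) * (t - z ^ q)))) ^ (q ^ i)) sums 0"
proof -
  have "(\<lambda>i. nm (exp_num z i) * nm (t ^ e / ((t - z) * (t - z ^ q))) ^ (q ^ i)) \<longlonglongrightarrow> 0"
    by (rule exp_num_decay) auto
  then have "(\<lambda>i. exp_num z i * (t ^ e / ((t - z) * (t - z ^ q))) ^ (q ^ i) * B ^ (q ^ i)) sums 0"
    by (intro sums_0_of_truncations[where m = "\<lambda>n. 2 * n + 2"] assms sum_exp_num_eq_0) auto
  moreover have "(t ^ e / ((t - z) * (t - z ^ q))) ^ (q ^ i) * B ^ (q ^ i) =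
      (t ^ e * (B / ((t - z) * (t - z ^ q)))) ^ (q ^ i)" for i
    by (simp flip: power_mult_distrib)
  ultimately show ?thesis by (simp add: mult.assoc)
qed

end

section \<open>Exponentials of Drinfeld modules\<close>

text \<open>\<open>U - V\<close> and \<open>Y - r * V\<close> are the values of the shtuka function \<open>1 / (X - w) - V\<close> and of its
  Frobenius twist at the point \<open>X = s\<close>, with \<open>r = V ^ (q - 1)\<close>; the two identities express \<open>x\<close> and
  \<open>y\<close> as functions of \<open>X\<close> through them.\<close>

lemma twisted_identity_x:
  fixes t w w' s U Y V W r :: "'a::field"
  assumes U: "U * (s - w) = 1" and Y: "Y * (s - w') = 1" and V: "V * (t - w) = 1" and W: "W * (t - w') = 1"
  shows "U * Y = V * W + (W + r * W) * (U - V) + W * (t - w) * ((U - V) * (Y - r * V))"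
proof -
  have "V * W + (W + r * W) * (U - V) + W * (t - w) * ((U - V) * (Y - r * V)) =
      W * U - W * Y + W * (t - w) * (U * Y) + (V * (t - w) - 1) * (r * W * V - r * W * U - W * Y)"
    by (simp add: algebra_simps)
  also have "W * U - W * Y + W * (t - w) * (U * Y) =
      U * Y * (W * (t - w')) - W * U * (Y * (s - w') - 1) + W * Y * (U * (s - w) - 1)"
    by (simp add: algebra_simps)
  finally show ?thesis unfolding U Y V W by simp
qed

lemma twisted_identity_y:
  fixes t w w' s U Y V W r :: "'a::field"
  assumes U: "U * (s - w) = 1" and Y: "Y * (s - w') = 1" and V: "V * (t - w) = 1" and W: "W * (t - w') = 1"
  shows "s * (U * Y) = t * (V * W) + (t * W + w' * r * W) * (U - V) + w' * (W * (t - w)) * ((U - V) * (Y - r * V))"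
proof -
  have "t * (V * W) + (t * W + w' * r * W) * (U - V) + w' * (W * (t - w)) * ((U - V) * (Y - r * V)) =
      t * W * U - w' * W * Y + w' * W * (t - w) * (U * Y) +
      (V * (t - w) - 1) * (w' * (r * W * V - r * W * U - W * Y))"
    by (simp add: algebra_simps)
  also have "t * W * U - w' * W * Y + w' * W * (t - w) * (U * Y) =
      s * U * Y * (W * (t - w')) - t * W * U * (Y * (s - w') - 1) + w' * W * Y * (U * (s - w) - 1)"
    by (simp add: algebra_simps)
  finally show ?thesis unfolding U Y V W by simp
qed

section \<open>Evaluation of twisted polynomials and uniqueness of the exponential\<close>

context frobenius_ultrametric_field
begin

lemma tau_eval_eq_sum:
  assumes "Polynomial.degree P \<le> n"
  shows "tau_eval q P (u :: 'c) = (\<Sum>i\<le>n. poly.coeff P i * u ^ (q ^ i))"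
  unfolding tau_eval_def using assms by (intro sum.mono_neutral_left) (auto simp: coeff_eq_0)

lemma tau_eval_add: "tau_eval q (P + Q) (u :: 'c) = tau_eval q P u + tau_eval q Q u"
  using tau_eval_eq_sum[of P "max (Polynomial.degree P) (Polynomial.degree Q)" u]
    tau_eval_eq_sum[of Q "max (Polynomial.degree P) (Polynomial.degree Q)" u]
    tau_eval_eq_sum[of "P + Q" "max (Polynomial.degree P) (Polynomial.degree Q)" u]
  by (simp add: degree_add_le_max sum.distrib distrib_right)

lemma tau_eval_0 [simp]: "tau_eval q 0 (u :: 'c) = 0"
  by (simp add: tau_eval_def)

lemma tau_eval_sum: "tau_eval q (\<Sum>i\<in>S. P i) (u :: 'c) = (\<Sum>i\<in>S. tau_eval q (P i) u)"
  by (induction S rule: infinite_finite_induct) (simp_all add: tau_eval_add)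

lemma tau_eval_monom: "tau_eval q (Polynomial.monom a k) (u :: 'c) = a * u ^ (q ^ k)"
proof -
  have "tau_eval q (Polynomial.monom a k) u = (\<Sum>i\<le>k. if i = k then a * u ^ (q ^ k) else 0)"
    by (subst tau_eval_eq_sum[OF degree_monom_le], rule sum.cong) auto
  then show ?thesis by simp
qed

lemma tau_eval_diff_right: "tau_eval q P (u - v :: 'c) = tau_eval q P u - tau_eval q P v"
  by (simp add: tau_eval_def frob_power_diff right_diff_distrib sum_subtractf)

lemma tau_eval_zero_right [simp]: "tau_eval q P (0 :: 'c) = 0"
  by (simp add: tau_eval_def frob_zero)

lemma tau_eval_tau_mult: "tau_eval q (tau_mult q P Q) (u :: 'c) = tau_eval q P (tau_eval q Q u)"
proof -
  have "tau_eval q P (tau_eval q Q u) =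
      (\<Sum>i\<le>Polynomial.degree P. poly.coeff P i * (\<Sum>j\<le>Polynomial.degree Q. (poly.coeff Q j * u ^ (q ^ j)) ^ (q ^ i)))"
    by (simp add: tau_eval_def frob_power_sum)
  also have "\<dots> = tau_eval q (tau_mult q P Q) u"
    unfolding tau_mult_def tau_eval_sum tau_eval_monom
    by (simp add: sum_distrib_left power_mult_distrib power_add mult_ac flip: power_mult)
  finally show ?thesis ..
qed

lemma tau_eval_const: "tau_eval q [:a:] (u :: 'c) = a * u"
  by (simp add: tau_eval_def)

lemma tau_eval_three: "tau_eval q [:a, b, c:] (u :: 'c) = a * u + b * u ^ q + c * u ^ (q ^ 2)"
  by (subst tau_eval_eq_sum[of _ 2]) (auto simp: numeral_2_eq_2 power2_eq_square)

lemma tau_eval_small: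
  assumes "nm (poly.coeff P 0) > 0"
  obtains \<delta> where "0 < \<delta>" "\<And>u. nm u < \<delta> \<Longrightarrow> nm (tau_eval q P u) = nm (poly.coeff P 0) * nm u"
proof
  define C where "C = (\<Sum>i\<le>Polynomial.degree P. nm (poly.coeff P i))"
  define \<delta> where "\<delta> = min 1 (nm (poly.coeff P 0) / (C + 1))"
  have C: "nm (poly.coeff P i) \<le> C" if "i \<le> Polynomial.degree P" for i
    unfolding C_def using that by (intro member_le_sum) auto
  have C0: "0 \<le> C" unfolding C_def by (intro sum_nonneg) simp
  show "0 < \<delta>" using assms C0 by (simp add: \<delta>_def)
  fix u assume u: "nm u < \<delta>"
  show "nm (tau_eval q P u) = nm (poly.coeff P 0) * nm u"
  proof (cases "u = 0")
    case False
    define R where "R = (\<Sum>i\<in>{1..Polynomial.degree P}. poly.coeff P i * u ^ (q ^ i))"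
    have "{..Polynomial.degree P} = insert 0 {1..Polynomial.degree P}" by auto
    then have split: "tau_eval q P u = poly.coeff P 0 * u + R"
      by (simp add: tau_eval_def R_def)
    have "nm R \<le> C * nm u ^ 2"
      unfolding R_def
    proof (rule nm_sum_le)
      fix i assume i: "i \<in> {1..Polynomial.degree P}"
      have "2 \<le> q ^ i" using i q_ge_2 self_le_power[of q i] by simp
      then have "nm u ^ (q ^ i) \<le> nm u ^ 2"
        using u by (intro power_decreasing) (auto simp: \<delta>_def)
      then show "nm (poly.coeff P i * u ^ q ^ i) \<le> C * nm u ^ 2"
        using C[of i] i C0 by (simp add: mult_mono)
    qed (use C0 in simp)
    also have "\<dots> = (C * nm u) * nm u" by (simp add: power2_eq_square)
    also have "\<dots> < nm (poly.coeff P 0) * nm u"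
    proof -
      have "C * nm u \<le> (C + 1) * nm u" by (simp add: algebra_simps)
      also have "\<dots> < nm (poly.coeff P 0)"
        using u C0 by (simp add: \<delta>_def field_simps)
      finally show ?thesis using False by simp
    qed
    finally have "nm R < nm (poly.coeff P 0 * u)" by simp
    then show ?thesis by (simp add: split nm_add_eq)
  qed simp
qed

text \<open>Convergence at 1 bounds the coefficients, and the exponents jump from
  \<open>q ^ k\<close> to at least \<open>q ^ k + 1\<close>, so the first nonzero term dominates
  near 0.\<close>

lemma additive_series_small:
  assumes summ: "summable d" and zero: "\<And>i. i < k \<Longrightarrow> d i = 0" and k: "d k \<noteq> 0"
  obtains \<delta> where "0 < \<delta>"
    "\<And>v s. nm v < \<delta> \<Longrightarrow> (\<lambda>i. d i * v ^ (q ^ i)) sums s \<Longrightarrow> nm s = nm (d k) * nm v ^ (q ^ k)"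
proof -
  have "d \<longlonglongrightarrow> 0" using summ by (rule tendsto_0_if_summable)
  then have "(\<lambda>i. nm (d i)) \<longlonglongrightarrow> 0" by (simp add: tendsto_iff_nm[of d])
  then obtain C where C: "0 < C" "\<And>i. nm (d i) \<le> C"
    using convergent_imp_Bseq[OF convergentI] by (metis BseqE norm_conv_dist real_norm_def abs_of_nonneg nm_nonneg)
  define \<delta> where "\<delta> = min 1 (nm (d k) / C)"
  have \<delta>: "0 < \<delta>" using C k by (simp add: \<delta>_def)
  have "nm s = nm (d k) * nm v ^ (q ^ k)"
    if v: "nm v < \<delta>" and s: "(\<lambda>i. d i * v ^ (q ^ i)) sums s" for v s
  proof (cases "v = 0")
    case True
    then have "(\<lambda>i. d i * v ^ (q ^ i)) = (\<lambda>i. 0)" by (simp add: frob_zero)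
    with s have "s = 0" by (simp add: sums_def LIMSEQ_const_iff)
    then show ?thesis using True by simp
  next
    case False
    have v1: "nm v \<le> 1" using v by (simp add: \<delta>_def)
    have sum: "(\<Sum>i<Suc k. d i * v ^ (q ^ i)) = d k * v ^ (q ^ k)"
      using zero by simp
    have "nm (s - (\<Sum>i<Suc k. d i * v ^ (q ^ i))) \<le> C * nm v ^ (q ^ Suc k)"
    proof (rule nm_sums_diff_le[OF s])
      fix i assume "Suc k \<le> i"
      then have "q ^ Suc k \<le> q ^ i" using q_ge_2 by (intro power_increasing) auto
      then have "nm v ^ (q ^ i) \<le> nm v ^ (q ^ Suc k)"
        by (rule power_decreasing) (use v1 in auto)
      then show "nm (d i * v ^ (q ^ i)) \<le> C * nm v ^ (q ^ Suc k)"
        using C by (simp add: mult_mono del: power_Suc)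
    qed (use C in simp)
    also have "C * nm v ^ (q ^ Suc k) \<le> C * nm v ^ Suc (q ^ k)"
    proof -
      have "1 \<le> q ^ k" by (simp add: Suc_le_eq)
      moreover have "2 * q ^ k \<le> q ^ Suc k" using q_ge_2 by simp
      ultimately have "Suc (q ^ k) \<le> q ^ Suc k" by linarith
      then show ?thesis
        using v1 C(1) by (intro mult_left_mono power_decreasing) auto
    qed
    also have "\<dots> = (C * nm v) * nm v ^ (q ^ k)" by simp
    also have "\<dots> < nm (d k) * nm v ^ (q ^ k)"
    proof -
      have "C * nm v < nm (d k)" using v C by (simp add: \<delta>_def field_simps)
      then show ?thesis using False by simp
    qed
    finally have "nm (s - d k * v ^ (q ^ k)) < nm (d k * v ^ (q ^ k))" unfolding sum by simp
    then show ?thesis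
      using nm_add_eq[of "s - d k * v ^ (q ^ k)" "d k * v ^ (q ^ k)"] by simp
  qed
  with \<delta> show ?thesis using that by blast
qed

text \<open>The difference D of two solutions satisfies D(xv) = phi_x(D v). Near 0 it behaves like a
  monomial of degree \<open>q ^ k\<close> with k > 0, and phi_x like multiplication by x. Hence
  \<open>|x|^(q^k) = |x|\<close>, which is impossible for |x| > 1. This is what gives access to the
  definite description in \<open>drinfeld_exp\<close>.\<close>

lemma exp_coeffs_unique:
  assumes c: "is_exp_coeffs q A \<phi> c" and c': "is_exp_coeffs q A \<phi> c'"
    and x: "x \<in> A" "poly.coeff (\<phi> x) 0 = x" "1 < nm x"
  shows "c = (c' :: nat \<Rightarrow> 'c)"
proof (rule ccontr)
  assume "c \<noteq> c'"
  define d where "d i = c i - c' i" for i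
  define D where "D v = (\<Sum>j. c j * v ^ (q ^ j)) - (\<Sum>j. c' j * v ^ (q ^ j))" for v
  have D: "(\<lambda>i. d i * v ^ (q ^ i)) sums D v" for v
  proof -
    have "(\<lambda>i. c i * v ^ (q ^ i) - c' i * v ^ (q ^ i)) sums D v"
      unfolding D_def using c c'
      by (intro sums_diff_nm summable_sums) (auto simp: is_exp_coeffs_def)
    then show ?thesis by (simp add: d_def left_diff_distrib)
  qed
  have Dx: "D (x * v) = tau_eval q (\<phi> x) (D v)" for v
    using c c' x(1) by (simp add: D_def tau_eval_diff_right is_exp_coeffs_def)
  define k where "k = (LEAST i. d i \<noteq> 0)"
  have ex: "\<exists>i. d i \<noteq> 0" using \<open>c \<noteq> c'\<close> by (auto simp: d_def fun_eq_iff)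
  have k: "d k \<noteq> 0" unfolding k_def by (rule LeastI_ex[OF ex])
  have zero: "d i = 0" if "i < k" for i
    using not_less_Least[of i "\<lambda>i. d i \<noteq> 0"] that by (auto simp: k_def)
  have "d 0 = 0" using c c' by (simp add: d_def is_exp_coeffs_def)
  then have "0 < k" using k by (cases k) auto
  have summ: "summable d" using D[of 1] by (simp add: summable_def) blast
  obtain \<delta> where \<delta>: "0 < \<delta>" "\<And>v. nm v < \<delta> \<Longrightarrow> nm (D v) = nm (d k) * nm v ^ (q ^ k)"
    using additive_series_small[OF summ zero k] D by metis
  obtain \<epsilon> where \<epsilon>: "0 < \<epsilon>" "\<And>u. nm u < \<epsilon> \<Longrightarrow> nm (tau_eval q (\<phi> x) u) = nm x * nm u"
    using tau_eval_small[of "\<phi> x"] x by (metis less_trans zero_less_one)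
  \<comment> \<open>The powers of 1/x supply nonzero points as close to 0 as required.\<close>
  define v where "v n = (1 / x) ^ n" for n
  have "(\<lambda>n. (1 / nm x) ^ n) \<longlonglongrightarrow> 0" using x(3) by (intro LIMSEQ_power_zero) (simp add: divide_less_eq)
  then have v0: "(\<lambda>n. nm (v n)) \<longlonglongrightarrow> 0" by (simp add: v_def)
  have "(\<lambda>n. nm x * nm (v n)) \<longlonglongrightarrow> nm x * 0" by (intro tendsto_intros v0)
  moreover have "(\<lambda>n. nm (d k) * nm (v n) ^ (q ^ k)) \<longlonglongrightarrow> nm (d k) * 0 ^ (q ^ k)"
    by (intro tendsto_intros v0)
  moreover have "(0::real) ^ (q ^ k) = 0" by (simp add: zero_power)
  ultimately have "\<forall>\<^sub>F n in sequentially. nm (v n) < \<delta> \<and> nm x * nm (v n) < \<delta> \<and> nm (d k) * nm (v n) ^ (q ^ k) < \<epsilon>"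
    using \<delta>(1) \<epsilon>(1) by (intro eventually_conj order_tendstoD(2)[OF v0]) (auto intro: order_tendstoD(2))
  then obtain n where n: "nm (v n) < \<delta>" "nm x * nm (v n) < \<delta>" "nm (d k) * nm (v n) ^ (q ^ k) < \<epsilon>"
    by (auto simp: eventually_sequentially)
  have Dv: "nm (D (v n)) = nm (d k) * nm (v n) ^ (q ^ k)"
    using \<delta>(2) n(1) by blast
  have "nm (d k) * (nm x * nm (v n)) ^ (q ^ k) = nm (D (x * v n))"
    using \<delta>(2)[of "x * v n"] n(2) by simp
  also have "\<dots> = nm x * nm (D (v n))"
    unfolding Dx using Dv n(3) by (intro \<epsilon>(2)) simp
  also have "\<dots> = nm (d k) * (nm x * nm (v n) ^ (q ^ k))"
    by (simp add: Dv)
  finally have "nm x ^ (q ^ k) = nm x"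
  proof -
    assume *: "nm (d k) * (nm x * nm (v n)) ^ (q ^ k) = nm (d k) * (nm x * nm (v n) ^ (q ^ k))"
    have "v n \<noteq> 0" using x(3) by (auto simp: v_def)
    with * k show ?thesis by (simp add: power_mult_distrib)
  qed
  moreover have "nm x ^ 1 < nm x ^ (q ^ k)"
    using x(3) q_ge_2 \<open>0 < k\<close> self_le_power[of q k] by (intro power_strict_increasing) auto
  ultimately show False by simp
qed

lemma drinfeld_exp_eq:
  assumes "is_exp_coeffs q A \<phi> c" "x \<in> A" "poly.coeff (\<phi> x) 0 = x" "1 < nm x"
  shows "drinfeld_exp q A \<phi> v = (\<Sum>j. c j * v ^ (q ^ j) :: 'c)"
proof -
  have "(THE c. is_exp_coeffs q A \<phi> c) = c"
    using assms exp_coeffs_unique by (intro the_equality) blast+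
  then show ?thesis by (simp add: drinfeld_exp_def)
qed

text \<open>The elements a whose equation holds at every v are closed under sums and products by the
  module laws, and scalars fixed by Frobenius pass through the series. So x and y suffice.\<close>

lemma is_exp_coeffs_adjoin:
  assumes mod: "drinfeld_module q F (adjoin F S) \<phi>"
    and F: "\<And>a. a \<in> F \<Longrightarrow> a ^ q = (a :: 'c)"
    and c0: "c 0 = 1" and summ: "\<And>v. summable (\<lambda>j. c j * v ^ (q ^ j))"
    and gens: "\<And>a v. a \<in> S \<Longrightarrow> tau_eval q (\<phi> a) (\<Sum>j. c j * v ^ (q ^ j)) = (\<Sum>j. c j * (a * v) ^ (q ^ j))"
  shows "is_exp_coeffs q (adjoin F S) \<phi> c"
proof -
  define E where "E v = (\<Sum>j. c j * v ^ (q ^ j))" for v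
  have E: "(\<lambda>j. c j * v ^ (q ^ j)) sums E v" for v
    unfolding E_def using summ by (rule summable_sums)
  have "tau_eval q (\<phi> a) (E v) = E (a * v)" if "a \<in> adjoin F S" for a v
    using that
  proof (induction a arbitrary: v rule: adjoin.induct)
    case (scalar a)
    have "a ^ (q ^ j) = a" for j
      using F[OF scalar] by (induction j) (simp_all add: power_mult mult.commute[of q])
    then have "(\<lambda>j. c j * (a * v) ^ (q ^ j)) = (\<lambda>j. a * (c j * v ^ (q ^ j)))"
      by (simp add: power_mult_distrib mult_ac)
    then have "E (a * v) = a * E v"
      using sums_cmult_nm[OF E[of v], of a] E[of "a * v"] by (metis sums_unique2)
    then show ?case using mod scalar by (simp add: drinfeld_module_def tau_eval_const)
  next
    case (gen a)
    then show ?case using gens by (simp add: E_def)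
  next
    case (add a b)
    have "E ((a + b) * v) = E (a * v) + E (b * v)"
      using sums_add_nm[OF E[of "a * v"] E[of "b * v"]] E[of "(a + b) * v"]
      by (simp add: frob_power_add distrib_right flip: distrib_left) (metis sums_unique2)
    moreover have "\<phi> (a + b) = \<phi> a + \<phi> b" using mod add.hyps by (simp add: drinfeld_module_def)
    ultimately show ?case by (simp add: tau_eval_add add.IH)
  next
    case (mult a b)
    have "\<phi> (a * b) = tau_mult q (\<phi> a) (\<phi> b)" using mod mult.hyps by (simp add: drinfeld_module_def)
    then show ?case by (simp add: tau_eval_tau_mult mult.IH mult.assoc)
  qed
  then show ?thesis using c0 summ by (simp add: is_exp_coeffs_def E_def)
qed

end

section \<open>Functional equations of the explicit series\<close>

context conjugate_places
begin

context
  fixes w w' \<eta> :: 'c and c :: "nat \<Rightarrow> 'c"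
  assumes ww': "w = z \<and> w' = z ^ q \<or> w = z ^ q \<and> w' = z"
    and eta: "\<eta> ^ (q - 1) = - (t - w)"
  defines "c \<equiv> \<lambda>i. exp_num w i * \<eta> ^ (q ^ i - 1)"
begin

lemma w_frob: "w ^ q = w'" "w' ^ q = w"
  using ww' z_period by (auto simp: power2_eq_square power_mult)

lemma t_power_neq_w: "t ^ (q ^ i) - w \<noteq> 0" "t ^ (q ^ i) - w' \<noteq> 0"
  using ww' t_power_neq_z[of i 0] t_power_neq_z[of i 1] by auto

lemma t_neq_w: "t - w \<noteq> 0" "t - w' \<noteq> 0"
  using t_power_neq_w[of 0] by auto

text \<open>Frobenius sends the factor j of index i to the factor j + 1 of index i + 1; the factor j
  = 0 is the only one left over.\<close>

lemma exp_num_frob: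
  "exp_num w i ^ q * (t ^ (q ^ Suc i) - w) = exp_num w (Suc i) * (t ^ (q ^ Suc i) - t)"
proof -
  have *: "t ^ (q ^ Suc i) - t \<noteq> 0"
    using t_power_eq_iff[of "Suc i" 0] by simp
  have "exp_num w i ^ q = (\<Prod>j<i. (t ^ (q ^ Suc i) - w ^ (q ^ Suc j)) / (t ^ (q ^ Suc i) - t ^ (q ^ Suc j)))"
    unfolding exp_num_def prod_power_distrib
    by (intro prod.cong refl) (simp add: power_divide frob_diff mult.commute[of q] flip: power_mult)
  moreover have "exp_num w (Suc i) = (t ^ (q ^ Suc i) - w) / (t ^ (q ^ Suc i) - t) *
      (\<Prod>j<i. (t ^ (q ^ Suc i) - w ^ (q ^ Suc j)) / (t ^ (q ^ Suc i) - t ^ (q ^ Suc j)))"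
    unfolding exp_num_def by (subst prod.lessThan_Suc_shift) simp
  ultimately show ?thesis
    using * by (simp add: mult.commute)
qed

text \<open>The choice of \<open>\<eta> ^ (q - 1)\<close> is made for this: multiplied by -(t - w),
  the difference of inverses becomes (s - t)/(s - w), the factor left over in
  \<open>exp_num_frob\<close>.\<close>

lemma exp_coeff_frob: "c i ^ q = c (Suc i) * (1 / (t ^ (q ^ Suc i) - w) - 1 / (t - w))"
proof -
  define s where "s = t ^ (q ^ Suc i)"
  have nz: "s - w \<noteq> 0" "t - w \<noteq> 0" "s - t \<noteq> 0"
    using t_power_neq_w[of "Suc i"] t_neq_w t_power_eq_iff[of "Suc i" 0] by (auto simp: s_def)
  have "q ^ Suc i - 1 = (q ^ i - 1) * q + (q - 1)"
  proof -
    have "q * 1 \<le> q * q ^ i" by (intro mult_le_mono2) (simp add: Suc_le_eq)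
    moreover have "(q ^ i - 1) * q = q * q ^ i - q"
      by (simp only: mult.commute[of _ q] diff_mult_distrib2 mult_1_right)
    ultimately show ?thesis using q_pos unfolding power_Suc by linarith
  qed
  then have h: "\<eta> ^ (q ^ Suc i - 1) = (\<eta> ^ (q ^ i - 1)) ^ q * - (t - w)"
    by (simp only: power_add power_mult eta)
  have e: "exp_num w i ^ q = exp_num w (Suc i) * (s - t) / (s - w)"
    using exp_num_frob[of i] nz by (simp add: s_def eq_divide_eq)
  have f: "- (t - w) * (1 / (s - w) - 1 / (t - w)) = (s - t) / (s - w)"
    using nz by (simp add: divide_simps) (simp add: algebra_simps)
  have "c (Suc i) * (1 / (s - w) - 1 / (t - w)) =
      exp_num w (Suc i) * (\<eta> ^ (q ^ i - 1)) ^ q * (- (t - w) * (1 / (s - w) - 1 / (t - w)))"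
    unfolding c_def h by (simp only: mult.assoc)
  also have "\<dots> = exp_num w (Suc i) * (s - t) / (s - w) * (\<eta> ^ (q ^ i - 1)) ^ q"
    unfolding f by (simp add: mult_ac)
  also have "\<dots> = c i ^ q"
    by (simp add: c_def e power_mult_distrib)
  finally show ?thesis by (simp add: s_def)
qed

text \<open>\<open>place_inv i\<close> and \<open>conj_place_inv i\<close> are the U and Y of
  \<open>twisted_identity_x\<close> at \<open>s = t ^ (q ^ i)\<close>. At i = 0 they are V and W,
  that is T and T^sigma in one order or the other.\<close>

definition "place_inv i = 1 / (t ^ (q ^ i) - w)"
definition "conj_place_inv i = 1 / (t ^ (q ^ i) - w')"

lemma place_inv_frob: "place_inv i ^ q = conj_place_inv (Suc i)" "conj_place_inv i ^ q = place_inv (Suc i)"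
  by (simp_all add: place_inv_def conj_place_inv_def power_divide frob_diff w_frob mult.commute[of q] flip: power_mult)

lemma place_inv_0: "place_inv 0 = 1 / (t - w)" "conj_place_inv 0 = 1 / (t - w')"
  by (simp_all add: place_inv_def conj_place_inv_def)

lemma place_inv_mult: "place_inv i * conj_place_inv i = (place_inv 0 * conj_place_inv 0) ^ (q ^ i)"
proof (induction i)
  case (Suc i)
  have "(place_inv 0 * conj_place_inv 0) ^ (q ^ Suc i) = (place_inv i * conj_place_inv i) ^ q"
    by (simp add: Suc power_mult mult.commute[of q])
  then show ?case by (simp add: power_mult_distrib place_inv_frob mult.commute)
qed simp

lemma c_shift1: "(case i of 0 \<Rightarrow> 0 | Suc k \<Rightarrow> c k ^ q) = c i * (place_inv i - place_inv 0)"
  by (cases i) (simp_all add: exp_coeff_frob place_inv_def)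

text \<open>These are the coefficients of the \<open>q^2\<close>-th power of the exponential. The
  zeros at i = 0 and i = 1 agree with the right-hand side, the second one because
  \<open>conj_place_inv 1 = place_inv 0 ^ q\<close>.\<close>

lemma c_shift2: "(case i of 0 \<Rightarrow> 0 | Suc k \<Rightarrow> (case k of 0 \<Rightarrow> 0 | Suc l \<Rightarrow> c l ^ q) ^ q) =
    c i * ((place_inv i - place_inv 0) * (conj_place_inv i - place_inv 0 ^ q))"
proof (cases i)
  case (Suc k)
  have "(c k * (place_inv k - place_inv 0)) ^ q = c k ^ q * (conj_place_inv i - place_inv 0 ^ q)"
    by (simp add: power_mult_distrib frob_diff place_inv_frob Suc)
  also have "c k ^ q = c i * (place_inv i - place_inv 0)"
    using c_shift1[of i] by (simp add: Suc)
  finally show ?thesis by (simp add: Suc c_shift1)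
qed simp

text \<open>This is c_i times the rational identity at X = \<open>t ^ (q ^ i)\<close>. Frobenius
  swaps the two inverses, so 1/pi evaluated there is \<open>x ^ (q ^ i)\<close>, the factor that x *
  v produces in the series.\<close>

lemma c_recursion_x:
  "c i * (place_inv 0 * conj_place_inv 0) ^ (q ^ i) = place_inv 0 * conj_place_inv 0 * c i +
    (conj_place_inv 0 + place_inv 0 ^ (q - 1) * conj_place_inv 0) * (c i * (place_inv i - place_inv 0)) +
    conj_place_inv 0 / place_inv 0 * (c i * ((place_inv i - place_inv 0) * (conj_place_inv i - place_inv 0 ^ q)))"
proof -
  have *: "place_inv 0 ^ q = place_inv 0 ^ (q - 1) * place_inv 0"
    by (metis power_minus_mult q_pos)
  have **: "conj_place_inv 0 / place_inv 0 = conj_place_inv 0 * (t - w)"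
    by (simp add: place_inv_def)
  have eq: "place_inv i * conj_place_inv i = place_inv 0 * conj_place_inv 0 + (conj_place_inv 0 + place_inv 0 ^ (q - 1) * conj_place_inv 0) * (place_inv i - place_inv 0) +
      conj_place_inv 0 * (t - w) * ((place_inv i - place_inv 0) * (conj_place_inv i - place_inv 0 ^ (q - 1) * place_inv 0))"
    by (rule twisted_identity_x[where s = "t ^ (q ^ i)" and w' = w'])
      (use t_power_neq_w t_neq_w in \<open>simp_all add: place_inv_def conj_place_inv_def\<close>)
  then show ?thesis
    unfolding place_inv_mult[symmetric] * ** eq by (simp add: algebra_simps)
qed

lemma c_recursion_y:
  "c i * (t * (place_inv 0 * conj_place_inv 0)) ^ (q ^ i) = t * (place_inv 0 * conj_place_inv 0) * c i +
    (t * conj_place_inv 0 + w' * place_inv 0 ^ (q - 1) * conj_place_inv 0) * (c i * (place_inv i - place_inv 0)) +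
    w' * (conj_place_inv 0 / place_inv 0) * (c i * ((place_inv i - place_inv 0) * (conj_place_inv i - place_inv 0 ^ q)))"
proof -
  have *: "place_inv 0 ^ q = place_inv 0 ^ (q - 1) * place_inv 0"
    by (metis power_minus_mult q_pos)
  have **: "conj_place_inv 0 / place_inv 0 = conj_place_inv 0 * (t - w)"
    by (simp add: place_inv_def)
  have eq: "t ^ (q ^ i) * (place_inv i * conj_place_inv i) = t * (place_inv 0 * conj_place_inv 0) + (t * conj_place_inv 0 + w' * place_inv 0 ^ (q - 1) * conj_place_inv 0) * (place_inv i - place_inv 0) +
      w' * (conj_place_inv 0 * (t - w)) * ((place_inv i - place_inv 0) * (conj_place_inv i - place_inv 0 ^ (q - 1) * place_inv 0))"
    by (rule twisted_identity_y[where s = "t ^ (q ^ i)"])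
      (use t_power_neq_w t_neq_w in \<open>simp_all add: place_inv_def conj_place_inv_def\<close>)
  then show ?thesis
    unfolding power_mult_distrib[of t] place_inv_mult[symmetric] * ** eq by (simp add: algebra_simps)
qed

lemma c_summable: "summable (\<lambda>i. c i * v ^ (q ^ i))"
proof -
  have "\<eta> \<noteq> 0"
  proof
    assume "\<eta> = 0"
    then have "- (t - w) = 0" using eta q_ge_2 by (simp add: power_0_left)
    then show False using t_neq_w by simp
  qed
  have eq: "c i * v ^ (q ^ i) = exp_num w i * (\<eta> * v) ^ (q ^ i) / \<eta>" for i
  proof -
    have "\<eta> ^ (q ^ i - 1) * \<eta> = \<eta> ^ (q ^ i)" by (metis power_minus_mult zero_less_power q_pos)
    then show ?thesis using \<open>\<eta> \<noteq> 0\<close> by (simp add: c_def power_mult_distrib eq_divide_eq mult_ac)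
  qed
  have "(\<lambda>i. nm (exp_num w i) * nm (\<eta> * v) ^ (q ^ i)) \<longlonglongrightarrow> 0"
    using ww' by (intro exp_num_decay) auto
  from tendsto_divide[OF this tendsto_const, of "nm \<eta>"]
  show ?thesis
    unfolding eq using \<open>\<eta> \<noteq> 0\<close> by (intro summable_if_tendsto_0) (simp add: tendsto_iff_nm)
qed

lemma exp_series_equation:
  assumes rec: "\<And>i. c i * a ^ (q ^ i) = a * c i + p1 * (c i * (place_inv i - place_inv 0)) +
      p2 * (c i * ((place_inv i - place_inv 0) * (conj_place_inv i - place_inv 0 ^ q)))"
  shows "tau_eval q [:a, p1, p2:] (\<Sum>i. c i * v ^ (q ^ i)) = (\<Sum>i. c i * (a * v) ^ (q ^ i))"
proof -
  define s where "s = (\<Sum>i. c i * v ^ (q ^ i))"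
  have s: "(\<lambda>i. c i * v ^ (q ^ i)) sums s"
    unfolding s_def by (rule summable_sums[OF c_summable])
  have frob: "(\<lambda>i. f i ^ q) sums u ^ q" if "f sums u" for f and u :: 'c
    using sums_frob_power[OF that, of 1] by simp
  have "(\<lambda>i. case i of 0 \<Rightarrow> 0 | Suc k \<Rightarrow> (c k * v ^ (q ^ k)) ^ q) sums s ^ q"
    by (rule sums_shift[OF frob[OF s]])
  also have "(\<lambda>i. case i of 0 \<Rightarrow> 0 | Suc k \<Rightarrow> (c k * v ^ (q ^ k)) ^ q) =
      (\<lambda>i. c i * (place_inv i - place_inv 0) * v ^ (q ^ i))"
    unfolding c_shift1[symmetric]
    by (auto simp: fun_eq_iff power_mult_distrib mult.commute[of q] split: nat.split simp flip: power_mult)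
  finally have s1: "(\<lambda>i. c i * (place_inv i - place_inv 0) * v ^ (q ^ i)) sums s ^ q" .
  have "(\<lambda>i. case i of 0 \<Rightarrow> 0 | Suc k \<Rightarrow> (c k * (place_inv k - place_inv 0) * v ^ (q ^ k)) ^ q) sums (s ^ q) ^ q"
    by (rule sums_shift[OF frob[OF s1]])
  also have "(\<lambda>i. case i of 0 \<Rightarrow> 0 | Suc k \<Rightarrow> (c k * (place_inv k - place_inv 0) * v ^ (q ^ k)) ^ q) =
      (\<lambda>i. c i * ((place_inv i - place_inv 0) * (conj_place_inv i - place_inv 0 ^ q)) * v ^ (q ^ i))"
    unfolding c_shift2[symmetric] c_shift1
    by (auto simp: fun_eq_iff power_mult_distrib mult.commute[of q] split: nat.split simp flip: power_mult)
  finally have s2: "(\<lambda>i. c i * ((place_inv i - place_inv 0) * (conj_place_inv i - place_inv 0 ^ q)) * v ^ (q ^ i)) sums s ^ (q ^ 2)"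
    by (simp add: power2_eq_square power_mult)
  have "(\<lambda>i. a * (c i * v ^ (q ^ i)) + p1 * (c i * (place_inv i - place_inv 0) * v ^ (q ^ i)) +
      p2 * (c i * ((place_inv i - place_inv 0) * (conj_place_inv i - place_inv 0 ^ q)) * v ^ (q ^ i))) sums (a * s + p1 * s ^ q + p2 * s ^ (q ^ 2))"
    by (intro sums_add_nm sums_cmult_nm s s1 s2)
  also have "(\<lambda>i. a * (c i * v ^ (q ^ i)) + p1 * (c i * (place_inv i - place_inv 0) * v ^ (q ^ i)) +
      p2 * (c i * ((place_inv i - place_inv 0) * (conj_place_inv i - place_inv 0 ^ q)) * v ^ (q ^ i))) = (\<lambda>i. c i * (a * v) ^ (q ^ i))"
  proof
    fix i
    have "c i * (a * v) ^ (q ^ i) = (c i * a ^ (q ^ i)) * v ^ (q ^ i)"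
      by (simp add: power_mult_distrib)
    then show "a * (c i * v ^ (q ^ i)) + p1 * (c i * (place_inv i - place_inv 0) * v ^ (q ^ i)) +
      p2 * (c i * ((place_inv i - place_inv 0) * (conj_place_inv i - place_inv 0 ^ q)) * v ^ (q ^ i)) = c i * (a * v) ^ (q ^ i)"
      unfolding rec by (simp add: algebra_simps)
  qed
  finally show ?thesis
    unfolding tau_eval_three s_def[symmetric] by (simp add: sums_unique)
qed

text \<open>V, W are T, T^sigma for \<open>w = z ^ q\<close> and T^sigma, T for
  \<open>w = z\<close>, so that both modules of the theorem are instances.\<close>

theorem exp_coeffs:
  defines "x \<equiv> 1 / ((t - w) * (t - w'))" and "V \<equiv> 1 / (t - w)" and "W \<equiv> 1 / (t - w')"
  assumes F: "\<And>a. a \<in> F \<Longrightarrow> a ^ q = (a :: 'c)"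
    and mod: "drinfeld_module q F (adjoin F {x, t * x}) \<phi>"
    and \<phi>x: "\<phi> x = [:x, W + V ^ (q - 1) * W, W / V:]"
    and \<phi>y: "\<phi> (t * x) = [:t * x, t * W + w' * V ^ (q - 1) * W, w' * (W / V):]"
  shows "is_exp_coeffs q (adjoin F {x, t * x}) \<phi> c"
proof (rule is_exp_coeffs_adjoin[OF mod F])
  have x: "x = place_inv 0 * conj_place_inv 0" and V: "V = place_inv 0" and W: "W = conj_place_inv 0"
    by (simp_all add: x_def V_def W_def place_inv_0)
  show "c 0 = 1" by (simp add: c_def)
  show "summable (\<lambda>j. c j * v ^ q ^ j)" for v by (rule c_summable)
  fix a v assume "a \<in> {x, t * x}"
  then consider "a = x" | "a = t * x" by blast
  then show "tau_eval q (\<phi> a) (\<Sum>j. c j * v ^ (q ^ j)) = (\<Sum>j. c j * (a * v) ^ (q ^ j))"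
  proof cases
    case 1
    show ?thesis unfolding 1 \<phi>x unfolding x V W by (rule exp_series_equation[OF c_recursion_x])
  next
    case 2
    show ?thesis unfolding 2 \<phi>y unfolding x V W by (rule exp_series_equation[OF c_recursion_y])
  qed
qed

end

end

section \<open>The zero sets\<close>

context frobenius_ultrametric_field
begin

text \<open>The \<open>x\<close>-torsion polynomial has at most \<open>q\<^sup>2\<close> roots, all accounted for by the \<open>q\<^sup>2\<close> values
  \<open>e ((a + b * s) / x)\<close>.\<close>

lemma additive_descent:
  fixes e :: "'c \<Rightarrow> 'c" and s x p1 p2 :: 'c and F :: "'c set"
  assumes diff: "\<And>u v. e (u - v) = e u - e v"
    and eq: "\<And>v. x * e v + p1 * e v ^ q + p2 * e v ^ (q ^ 2) = e (x * v)"
    and x: "x \<noteq> 0" and F: "card F = q" "\<And>a b. a \<in> F \<Longrightarrow> b \<in> F \<Longrightarrow> a - b \<in> F"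
    and zero: "\<And>a b. a \<in> F \<Longrightarrow> b \<in> F \<Longrightarrow> e (a + b * s) = 0"
    and inj: "\<And>a b. a \<in> F \<Longrightarrow> b \<in> F \<Longrightarrow> e ((a + b * s) / x) = 0 \<Longrightarrow> a = 0 \<and> b = 0"
    and \<mu>: "e \<mu> = 0"
  obtains a b where "a \<in> F" "b \<in> F" "e ((\<mu> - (a + b * s)) / x) = 0"
proof -
  define R where "R = [:0, x:] + Polynomial.monom p1 q + Polynomial.monom p2 (q ^ 2)"
  have R: "poly R u = x * u + p1 * u ^ q + p2 * u ^ (q ^ 2)" for u
    by (simp add: R_def poly_monom mult.commute)
  have q2: "q \<le> q ^ 2" using q_ge_2 by (simp add: power2_eq_square)
  have "Polynomial.degree R \<le> q ^ 2"
    unfolding R_def using q2 q_ge_2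
    by (intro degree_add_le order_trans[OF degree_monom_le]) auto
  moreover have "poly.coeff R 1 = x"
    using q2 q_ge_2 by (simp add: R_def)
  then have "R \<noteq> 0" using x by auto
  ultimately have card: "finite {u. poly R u = 0}" "card {u. poly R u = 0} \<le> q ^ 2"
    using poly_roots_finite[of R] card_poly_roots_bound[of R] by (meson order_trans)+
  define h where "h = (\<lambda>(a, b). e ((a + b * s) / x))"
  have "inj_on h (F \<times> F)"
  proof (rule inj_onI)
    fix u v assume uv: "u \<in> F \<times> F" "v \<in> F \<times> F" "h u = h v"
    obtain a b a' b' where [simp]: "u = (a, b)" "v = (a', b')" by (cases u; cases v)
    have "((a - a') + (b - b') * s) / x = (a + b * s) / x - (a' + b' * s) / x"
      by (simp add: algebra_simps add_divide_distrib diff_divide_distrib)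
    then have "e (((a - a') + (b - b') * s) / x) = 0"
      using uv(3) by (simp add: h_def diff)
    then have "a - a' = 0 \<and> b - b' = 0" using uv F(2) by (intro inj) auto
    then show "u = v" by simp
  qed
  then have "card (h ` (F \<times> F)) = q ^ 2"
    by (simp add: card_image card_cartesian_product F power2_eq_square)
  moreover have sub: "h ` (F \<times> F) \<subseteq> {u. poly R u = 0}"
    using zero x by (auto simp: h_def R eq)
  ultimately have "h ` (F \<times> F) = {u. poly R u = 0}"
    using card by (intro card_seteq) auto
  moreover have "poly R (e (\<mu> / x)) = 0"
    using \<mu> x by (simp add: R eq)
  ultimately have "e (\<mu> / x) \<in> h ` (F \<times> F)" by simp
  then obtain a b where ab: "a \<in> F" "b \<in> F" "e (\<mu> / x) = e ((a + b * s) / x)"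
    by (auto simp: h_def)
  then have "e ((\<mu> - (a + b * s)) / x) = 0"
    by (simp add: diff_divide_distrib diff)
  then show ?thesis using ab that by blast
qed

text \<open>Needed to conclude from a small \<open>u ^ q - u\<close> that u is close to some element
  of F.\<close>

lemma prod_minus_fixed_field:
  assumes "card F = q" and F: "\<And>a. a \<in> F \<Longrightarrow> a ^ q = (a :: 'c)"
  shows "(\<Prod>a\<in>F. u - a) = u ^ q - u"
proof -
  define P where "P = (\<Prod>a\<in>F. [:- a, 1:])"
  define R where "R = Polynomial.monom 1 q - [:0, 1 :: 'c:]"
  have fin: "finite F" using assms(1) q_pos by (metis card.infinite less_irrefl)
  have degP: "Polynomial.degree P = q"
    unfolding P_def by (subst degree_prod_eq_sum_degree) (use assms in auto)
  have "P = R"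
  proof (rule poly_eqI_degree_lead_coeff)
    have "poly.coeff P q = 1"
      using lead_coeff_prod[of "\<lambda>a. [:- a, 1:]" F] degP by (simp add: P_def)
    then show "poly.coeff P q = poly.coeff R q"
      using q_ge_2 by (simp add: R_def coeff_eq_0)
    show "Polynomial.degree R \<le> q"
      unfolding R_def using q_ge_2 by (intro degree_diff_le degree_monom_le) auto
    show "poly P a = poly R a" if "a \<in> F" for a
      using that fin F by (auto simp: P_def R_def poly_prod poly_monom)
  qed (use assms(1) degP in auto)
  then have "poly P u = poly R u" by simp
  then show ?thesis by (simp add: P_def R_def poly_prod poly_monom)
qed

end

text \<open>\<open>F_indep\<close> expresses that 1 and \<open>z ^ q\<close> remain linearly
  independent over F after reduction modulo the open unit ball. Since t reduces to
  \<open>z ^ q\<close>, the same follows for 1 and t.\<close>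

locale constant_field = conjugate_places nm q z t \<beta>
  for nm :: "'c::{field, complete_space} \<Rightarrow> real" and q z t \<beta> +
  fixes F :: "'c set"
  assumes F_frob: "a \<in> F \<Longrightarrow> a ^ q = a"
    and F_card: "card F = q"
    and F_1: "1 \<in> F"
    and F_diff: "a \<in> F \<Longrightarrow> b \<in> F \<Longrightarrow> a - b \<in> F"
    and F_indep: "a \<in> F \<Longrightarrow> b \<in> F \<Longrightarrow> nm (a + b * z ^ q) < 1 \<Longrightarrow> a = 0 \<and> b = 0"
begin

lemma F_0: "0 \<in> F"
  using F_diff[OF F_1 F_1] by simp

lemma F_minus: "a \<in> F \<Longrightarrow> - a \<in> F"
  using F_diff[OF F_0] by simp

lemma nm_F_le: "a \<in> F \<Longrightarrow> nm a \<le> 1"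
proof (rule ccontr)
  assume "a \<in> F" "\<not> nm a \<le> 1"
  then have "nm a ^ 1 < nm a ^ q" using q_ge_2 by (intro power_strict_increasing) auto
  also have "nm a ^ q = nm a" using F_frob[OF \<open>a \<in> F\<close>] nm_power by metis
  finally show False by simp
qed

lemma nm_t_le: "nm t \<le> 1"
  using nm_add_le'[of "t - z" 1 z] nm_t_z nm_z_le by simp

definition x :: 'c where "x = 1 / ((t - z) * (t - z ^ q))"
definition A :: "'c set" where "A = adjoin F {x, t * x}"

lemma x_neq_0: "x \<noteq> 0"
  using t_power_neq_z[of 0 0] t_power_neq_z[of 0 1] by (simp add: x_def)

lemma nm_x: "nm x = 1 / \<beta>"
  by (simp add: x_def nm_t nm_t_z)

lemma F_indep_t:
  assumes "a \<in> F" "b \<in> F" "nm (a + b * t) < 1"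
  shows "a = 0 \<and> b = 0"
proof -
  have "nm b * \<beta> \<le> 1 * \<beta>"
    using nm_F_le[OF assms(2)] beta by (intro mult_right_mono) auto
  then have "nm (b * (t - z ^ q)) < 1" unfolding nm_mult nm_t using beta by linarith
  with assms(3) have "nm ((a + b * t) - b * (t - z ^ q)) < 1" by (rule nm_diff_less)
  also have "(a + b * t) - b * (t - z ^ q) = a + b * z ^ q" by (simp add: algebra_simps)
  finally show ?thesis using assms F_indep by blast
qed

lemma nm_combination_le:
  assumes "a \<in> F" "b \<in> F" "nm s \<le> r" "1 \<le> r"
  shows "nm (a + b * s) \<le> r"
proof (rule nm_add_le')
  show "nm a \<le> r" using nm_F_le[OF assms(1)] assms(4) by linarith
  have "nm b * nm s \<le> 1 * r"
    using nm_F_le[OF assms(2)] assms(3) by (intro mult_mono) auto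
  then show "nm (b * s) \<le> r" by simp
qed

context
  fixes w \<kappa> \<eta> \<omega> :: 'c and \<phi> :: "'c \<Rightarrow> 'c poly" and c :: "nat \<Rightarrow> 'c" and p1 p2 :: 'c
  assumes ww: "w = z \<or> w = z ^ q"
    and nz: "\<kappa> \<noteq> 0" "\<omega> \<noteq> 0"
  defines "\<eta> \<equiv> \<kappa> / \<omega>"
    and "c \<equiv> \<lambda>i. exp_num w i * \<eta> ^ (q ^ i - 1)"
  assumes exp: "is_exp_coeffs q A \<phi> c"
    and \<phi>x: "\<phi> x = [:x, p1, p2:]"
begin

text \<open>Scaling by \<omega> turns the expected lattice into a subset of K. By
  \<open>scaled_exp_sums'\<close>, \<eta> times this function is a series in
  \<open>\<kappa> * \<mu>\<close> with coefficients \<open>exp_num w j\<close>, from which \<omega>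
  has disappeared.\<close>

definition scaled_exp :: "'c \<Rightarrow> 'c" where "scaled_exp \<mu> = (\<Sum>j. c j * (\<omega> * \<mu>) ^ (q ^ j))"

lemma eta_nz: "\<eta> \<noteq> 0"
  using nz by (simp add: \<eta>_def)

lemma scaled_exp_sums: "(\<lambda>j. c j * (\<omega> * \<mu>) ^ (q ^ j)) sums scaled_exp \<mu>"
  unfolding scaled_exp_def using exp by (intro summable_sums) (simp add: is_exp_coeffs_def)

lemma scaled_exp_sums': "(\<lambda>j. exp_num w j * (\<kappa> * \<mu>) ^ (q ^ j)) sums (\<eta> * scaled_exp \<mu>)"
proof -
  have "\<eta> * (c j * (\<omega> * \<mu>) ^ (q ^ j)) = exp_num w j * (\<kappa> * \<mu>) ^ (q ^ j)" for j
  proof -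
    have "\<eta> ^ (q ^ j - 1) * \<eta> = \<eta> ^ (q ^ j)" by (metis power_minus_mult zero_less_power q_pos)
    then have "\<eta> * (c j * (\<omega> * \<mu>) ^ (q ^ j)) = exp_num w j * (\<eta> * (\<omega> * \<mu>)) ^ (q ^ j)"
      by (simp add: c_def power_mult_distrib mult_ac)
    also have "\<eta> * (\<omega> * \<mu>) = \<kappa> * \<mu>" using nz by (simp add: \<eta>_def)
    finally show ?thesis .
  qed
  then show ?thesis using sums_cmult_nm[OF scaled_exp_sums, of \<eta> \<mu>] by simp
qed

lemma scaled_exp_diff: "scaled_exp (u - v) = scaled_exp u - scaled_exp v"
proof -
  have "(\<lambda>j. c j * (\<omega> * u) ^ (q ^ j) - c j * (\<omega> * v) ^ (q ^ j)) sums (scaled_exp u - scaled_exp v)"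
    by (intro sums_diff_nm scaled_exp_sums)
  then have "(\<lambda>j. c j * (\<omega> * (u - v)) ^ (q ^ j)) sums (scaled_exp u - scaled_exp v)"
    by (simp add: frob_power_diff right_diff_distrib)
  with scaled_exp_sums show ?thesis by (rule sums_unique2)
qed

lemma scaled_exp_add: "scaled_exp (u + v) = scaled_exp u + scaled_exp v"
  using scaled_exp_diff[of "u + v" v] by simp

lemma scaled_exp_action: "a \<in> A \<Longrightarrow> tau_eval q (\<phi> a) (scaled_exp \<mu>) = scaled_exp (a * \<mu>)"
  using exp by (simp add: is_exp_coeffs_def scaled_exp_def mult.left_commute)

lemma scaled_exp_module: "a \<in> A \<Longrightarrow> scaled_exp \<mu> = 0 \<Longrightarrow> scaled_exp (a * \<mu>) = 0"
  using scaled_exp_action[of a \<mu>] by simp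

lemma A_add: "a \<in> A \<Longrightarrow> b \<in> A \<Longrightarrow> a + b \<in> A"
  and A_mult: "a \<in> A \<Longrightarrow> b \<in> A \<Longrightarrow> a * b \<in> A"
  unfolding A_def by (auto intro: adjoin.add adjoin.mult)

lemma x_in_A: "x \<in> A" and y_in_A: "t * x \<in> A" and F_in_A: "a \<in> F \<Longrightarrow> a \<in> A"
  by (auto simp: A_def intro: adjoin.intros)

lemma scaled_exp_x: "x * scaled_exp v + p1 * scaled_exp v ^ q + p2 * scaled_exp v ^ (q ^ 2) = scaled_exp (x * v)"
  using scaled_exp_action[OF x_in_A, of v] by (simp add: \<phi>x tau_eval_three)

text \<open>Under \<open>small\<close> every term after the linear one is at most
  \<open>|\<kappa>| |\<mu>|^2\<close>, which is below \<open>|\<kappa> \<mu>|\<close> when 0 <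
  \<open>|\<mu>|\<close> < 1.\<close>

lemma scaled_exp_inj_open_disc:
  assumes small: "\<And>i. 1 \<le> i \<Longrightarrow> nm (exp_num w i) * nm \<kappa> ^ (q ^ i - 1) \<le> 1"
    and \<mu>: "scaled_exp \<mu> = 0" "nm \<mu> < 1"
  shows "\<mu> = 0"
proof (rule ccontr)
  assume "\<mu> \<noteq> 0"
  have "nm (\<eta> * scaled_exp \<mu> - (\<Sum>i<1. exp_num w i * (\<kappa> * \<mu>) ^ (q ^ i))) \<le> nm \<kappa> * nm \<mu> ^ 2"
  proof (rule nm_sums_diff_le[OF scaled_exp_sums'])
    fix i :: nat assume i: "1 \<le> i"
    have "nm \<kappa> ^ (q ^ i) = nm \<kappa> ^ (q ^ i - 1) * nm \<kappa>" by (metis power_minus_mult zero_less_power q_pos)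
    then have "nm (exp_num w i * (\<kappa> * \<mu>) ^ (q ^ i)) = (nm (exp_num w i) * nm \<kappa> ^ (q ^ i - 1)) * (nm \<kappa> * nm \<mu> ^ (q ^ i))"
      by (simp add: power_mult_distrib mult_ac)
    also have "\<dots> \<le> 1 * (nm \<kappa> * nm \<mu> ^ (q ^ i))"
      using small[OF i] by (intro mult_right_mono) auto
    also have "\<dots> \<le> nm \<kappa> * nm \<mu> ^ 2"
    proof -
      have "2 \<le> q ^ i" using i q_ge_2 self_le_power[of q i] by simp
      then have "nm \<mu> ^ (q ^ i) \<le> nm \<mu> ^ 2" by (rule power_decreasing) (use \<mu> in auto)
      then show ?thesis by (simp add: mult_left_mono)
    qed
    finally show "nm (exp_num w i * (\<kappa> * \<mu>) ^ (q ^ i)) \<le> nm \<kappa> * nm \<mu> ^ 2" .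
  qed simp
  then have "nm \<kappa> * nm \<mu> \<le> nm \<kappa> * nm \<mu> ^ 2" by (simp add: \<mu>)
  then have "nm \<mu> \<le> nm \<mu> * nm \<mu>" using nz by (simp add: power2_eq_square)
  then show False using \<mu> \<open>\<mu> \<noteq> 0\<close> by simp
qed

text \<open>Induction on n with \<open>|\<mu>| \<le> \<beta>^(-n)\<close>. The bound on s ensures
  that subtracting a + b * s does not spoil the estimate, and dividing by x gains exactly one factor
  \<beta>.\<close>

lemma scaled_exp_kernel_subset:
  assumes base: "\<And>\<mu>. scaled_exp \<mu> = 0 \<Longrightarrow> nm \<mu> \<le> 1 \<Longrightarrow> \<mu> \<in> L"
    and closed: "\<And>a b \<nu>. a \<in> F \<Longrightarrow> b \<in> F \<Longrightarrow> \<nu> \<in> L \<Longrightarrow> (a + b * s) + x * \<nu> \<in> L"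
    and zero: "\<And>a b. a \<in> F \<Longrightarrow> b \<in> F \<Longrightarrow> scaled_exp (a + b * s) = 0"
    and inj: "\<And>a b. a \<in> F \<Longrightarrow> b \<in> F \<Longrightarrow> scaled_exp ((a + b * s) / x) = 0 \<Longrightarrow> a = 0 \<and> b = 0"
    and s: "nm s \<le> 1 / \<beta>"
    and \<mu>: "scaled_exp \<mu> = 0"
  shows "\<mu> \<in> L"
proof -
  have "\<mu> \<in> L" if "nm \<mu> \<le> (1 / \<beta>) ^ n" "scaled_exp \<mu> = 0" for n \<mu>
    using that
  proof (induction n arbitrary: \<mu>)
    case 0
    then show ?case using base by simp
  next
    case (Suc n)
    obtain a b where ab: "a \<in> F" "b \<in> F" "scaled_exp ((\<mu> - (a + b * s)) / x) = 0"
      by (rule additive_descent[OF scaled_exp_diff scaled_exp_x x_neq_0 F_card F_diff zero inj Suc.prems(2)])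
    define \<nu> where "\<nu> = (\<mu> - (a + b * s)) / x"
    have one: "1 \<le> (1 / \<beta>) ^ n" using beta by (intro one_le_power) simp
    have "nm (a + b * s) \<le> 1 / \<beta>"
      using nm_combination_le[OF ab(1,2) s] beta by simp
    also have "1 / \<beta> \<le> (1 / \<beta>) ^ Suc n"
      using mult_left_mono[OF one, of "1 / \<beta>"] beta by simp
    finally have "nm (\<mu> - (a + b * s)) \<le> (1 / \<beta>) ^ Suc n"
      using Suc.prems(1) by (intro nm_diff_le')
    then have "nm \<nu> \<le> (1 / \<beta>) ^ n"
      using beta by (simp add: \<nu>_def nm_x field_simps)
    then have "\<nu> \<in> L" using Suc.IH ab(3) by (simp add: \<nu>_def)
    moreover have "\<mu> = (a + b * s) + x * \<nu>" using x_neq_0 by (simp add: \<nu>_def)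
    ultimately show ?case using closed ab by metis
  qed
  moreover obtain n where "nm \<mu> < (1 / \<beta>) ^ n"
    using real_arch_pow[of "1 / \<beta>" "nm \<mu>"] beta by auto
  ultimately show ?thesis using \<mu> less_imp_le by blast
qed

lemma zero_set_eq_image:
  "{\<mu>. scaled_exp \<mu> = 0} = L \<Longrightarrow> {v. (\<Sum>j. c j * v ^ (q ^ j)) = 0} = (\<lambda>a. \<omega> * a) ` L"
proof -
  assume L: "{\<mu>. scaled_exp \<mu> = 0} = L"
  have "(\<Sum>j. c j * v ^ (q ^ j)) = scaled_exp (v / \<omega>)" for v
    using nz by (simp add: scaled_exp_def)
  then show ?thesis
    unfolding L[symmetric] using nz by (auto simp: image_iff intro!: exI[of _ "_ / \<omega>"])
qed

text \<open>Here \<kappa> has absolute value 1, so on the closed unit disc the terms i = 0 and i = 1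
  compete while all others are at most \<beta>. The zeros there turn out to be F, and descent with s
  = y gives the rest of A.\<close>

lemma kernel_conj:
  assumes w: "w = z ^ q" and \<kappa>: "\<kappa> = B / (t - z)"
    and B: "tail_prod \<longlonglongrightarrow> B" "nm B = 1"
  shows "{v. (\<Sum>j. c j * v ^ (q ^ j)) = 0} = (\<lambda>a. \<omega> * a) ` A"
proof (rule zero_set_eq_image)
  have nm\<kappa>: "nm \<kappa> = 1" using B by (simp add: \<kappa> nm_t_z)
  have "(\<lambda>i. exp_num w i * (\<kappa> * 1) ^ (q ^ i)) sums 0"
    using exp_num_conj_zero[OF B] by (simp add: w \<kappa>)
  from sums_unique2[OF this scaled_exp_sums'] have e1: "scaled_exp 1 = 0" using eta_nz by simp
  have sub: "scaled_exp a = 0" if "a \<in> A" for a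
    using scaled_exp_module[OF that e1] by simp
  have closed_disc: "\<mu> \<in> F" if \<mu>: "scaled_exp \<mu> = 0" "nm \<mu> \<le> 1" for \<mu>
  proof -
    have tail: "nm (\<kappa> * \<mu> + exp_num w 1 * (\<kappa> * \<mu>) ^ q) \<le> \<beta>" if \<mu>: "scaled_exp \<mu> = 0" "nm \<mu> \<le> 1" for \<mu>
    proof -
      have "nm (\<eta> * scaled_exp \<mu> - (\<Sum>i<2. exp_num w i * (\<kappa> * \<mu>) ^ (q ^ i))) \<le> \<beta>"
      proof (rule nm_sums_diff_le[OF scaled_exp_sums'])
        fix i :: nat assume "2 \<le> i"
        then have "nm (exp_num w i) * nm (\<kappa> * \<mu>) ^ (q ^ i) \<le> \<beta> * 1"
          using nm_exp_num_conj_less_one \<mu>(2) beta by (intro mult_mono) (simp_all add: w nm\<kappa> power_le_one)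
        then show "nm (exp_num w i * (\<kappa> * \<mu>) ^ (q ^ i)) \<le> \<beta>" by simp
      qed (use beta in simp)
      also have "(\<Sum>i<2. exp_num w i * (\<kappa> * \<mu>) ^ (q ^ i)) = \<kappa> * \<mu> + exp_num w 1 * (\<kappa> * \<mu>) ^ q"
        by (simp add: numeral_2_eq_2)
      finally show ?thesis by (simp only: \<mu>(1) mult_zero_right diff_0 nm_minus)
    qed
    \<comment> \<open>The known zero 1 shows that this is at most \<beta>. Subtracting the two-term
      estimate for \<mu> from \<open>\<theta> * \<mu> ^ q\<close> eliminates
      \<open>exp_num w 1\<close> and leaves \<open>\<kappa> * (\<mu> ^ q - \<mu>)\<close>.\<close>
    define \<theta> where "\<theta> = \<kappa> * 1 + exp_num w 1 * (\<kappa> * 1) ^ q"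
    have "nm \<theta> \<le> \<beta>" unfolding \<theta>_def by (rule tail[OF e1]) simp
    then have "nm \<theta> * nm \<mu> ^ q \<le> \<beta> * 1"
      using \<mu>(2) beta by (intro mult_mono power_le_one) simp_all
    then have "nm (\<theta> * \<mu> ^ q - (\<kappa> * \<mu> + exp_num w 1 * (\<kappa> * \<mu>) ^ q)) \<le> \<beta>"
      by (intro nm_diff_le' tail[OF \<mu>]) simp
    also have "\<theta> * \<mu> ^ q - (\<kappa> * \<mu> + exp_num w 1 * (\<kappa> * \<mu>) ^ q) = \<kappa> * (\<mu> ^ q - \<mu>)"
      by (simp add: \<theta>_def algebra_simps power_mult_distrib)
    finally have "nm (\<mu> ^ q - \<mu>) \<le> \<beta>" by (simp only: nm_mult nm\<kappa> mult_1)
    then have small: "nm (\<Prod>a\<in>F. \<mu> - a) < 1"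
      using beta by (simp only: prod_minus_fixed_field[OF F_card F_frob])
    have "\<exists>a\<in>F. nm (\<mu> - a) < 1"
    proof (rule ccontr)
      assume "\<not> (\<exists>a\<in>F. nm (\<mu> - a) < 1)"
      then have "1 \<le> nm (\<Prod>a\<in>F. \<mu> - a)"
        unfolding nm_prod by (intro prod_ge_1) auto
      with small show False by simp
    qed
    then obtain a where a: "a \<in> F" "nm (\<mu> - a) < 1" by blast
    have "scaled_exp (\<mu> - a) = 0" using \<mu> sub[OF F_in_A[OF a(1)]] by (simp add: scaled_exp_diff)
    then have "\<mu> - a = 0"
      by (rule scaled_exp_inj_open_disc[rotated]) (simp_all add: a nm\<kappa> w nm_exp_num_conj_le_one)
    then show "\<mu> \<in> F" using a by simp
  qed
  show "{\<mu>. scaled_exp \<mu> = 0} = A"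
  proof (intro equalityI subsetI)
    fix \<mu> assume "\<mu> \<in> {\<mu>. scaled_exp \<mu> = 0}"
    then have \<mu>: "scaled_exp \<mu> = 0" by simp
    show "\<mu> \<in> A"
    proof (rule scaled_exp_kernel_subset[where s = "t * x", OF _ _ _ _ _ \<mu>])
      show "\<mu> \<in> A" if "scaled_exp \<mu> = 0" "nm \<mu> \<le> 1" for \<mu> using closed_disc[OF that] F_in_A by simp
      show cl: "a + b * (t * x) + x * \<nu> \<in> A" if "a \<in> F" "b \<in> F" "\<nu> \<in> A" for a b \<nu>
        using that F_in_A x_in_A y_in_A by (intro A_add A_mult[OF _ y_in_A] A_mult[OF x_in_A]) auto
      show "scaled_exp (a + b * (t * x)) = 0" if "a \<in> F" "b \<in> F" for a b
        using cl[OF that, of 0] that F_in_A[OF F_0] by (intro sub) simp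
      show "nm (t * x) \<le> 1 / \<beta>"
        using nm_t_le beta by (simp add: nm_x divide_right_mono)
      \<comment> \<open>The zero a/x + b * t lies in the closed disc, hence in F. It differs from b
        * t by a/x, which is small, so the independence of 1 and t makes both vanish.\<close>
      show "a = 0 \<and> b = 0" if ab: "a \<in> F" "b \<in> F" "scaled_exp ((a + b * (t * x)) / x) = 0" for a b
      proof -
        have eq: "(a + b * (t * x)) / x = a / x + b * t"
          using x_neq_0 by (simp add: add_divide_distrib)
        have ax: "nm (a / x) < 1"
        proof -
          have "nm (a / x) \<le> \<beta>" using nm_F_le[OF ab(1)] beta by (simp add: nm_x mult_left_le_one_le)
          then show ?thesis using beta by simp
        qed
        have "nm (b * t) \<le> 1"
          using nm_F_le[OF ab(2)] nm_t_le by (simp add: mult_le_one)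
        then have "nm (a / x + b * t) \<le> 1" using ax by (intro nm_add_le') auto
        then have g: "a / x + b * t \<in> F" using ab(3) closed_disc unfolding eq by blast
        have "nm (- (a / x + b * t) + b * t) < 1" using ax by (simp add: algebra_simps)
        then have "- (a / x + b * t) = 0 \<and> b = 0"
          using F_minus[OF g] ab(2) by (intro F_indep_t) auto
        then show ?thesis using x_neq_0 by auto
      qed
    qed
  qed (use sub in simp)
qed

text \<open>Now \<kappa> has absolute value 1/\<beta>, but the coefficients decay fast enough for 0
  to be the only zero in the open unit disc. A single descent step with s = t takes the closed disc
  to radius \<beta>, so the zeros there are the a + b * t with a, b in F.\<close>

lemma kernel_z:
  assumes w: "w = z" and \<kappa>: "\<kappa> = B / ((t - z) * (t - z ^ q))"
    and B: "tail_prod \<longlonglongrightarrow> B" "nm B = 1"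
  shows "{v. (\<Sum>j. c j * v ^ (q ^ j)) = 0} = (\<lambda>a. \<omega> * a) ` {a + t * b | a b. a \<in> A \<and> b \<in> A}"
proof (rule zero_set_eq_image)
  let ?L = "{a + t * b | a b. a \<in> A \<and> b \<in> A}"
  have nm\<kappa>: "nm \<kappa> = 1 / \<beta>" using B by (simp add: \<kappa> nm_t_z nm_t)
  have exp_t_power: "scaled_exp (t ^ k) = 0" if "k \<le> 1" for k
  proof -
    have "(\<lambda>i. exp_num w i * (\<kappa> * t ^ k) ^ (q ^ i)) sums 0"
      using exp_num_zero[OF B that] by (simp add: w \<kappa> mult.commute)
    from sums_unique2[OF this scaled_exp_sums'] show ?thesis using eta_nz by simp
  qed
  have sub: "scaled_exp (a + t * b) = 0" if "a \<in> A" "b \<in> A" for a b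
    using scaled_exp_module[OF that(1) exp_t_power[of 0]] scaled_exp_module[OF that(2) exp_t_power[of 1]] by (simp add: scaled_exp_add mult.commute)
  have inj: "\<mu> = 0" if "scaled_exp \<mu> = 0" "nm \<mu> < 1" for \<mu>
  proof (rule scaled_exp_inj_open_disc[OF _ that])
    fix i :: nat assume i: "1 \<le> i"
    have p: "\<beta> ^ (q ^ i) = \<beta> ^ (q ^ i - 1) * \<beta>" by (metis power_minus_mult zero_less_power q_pos)
    \<comment> \<open>For even i the factor j = 0 alone yields this power; for odd i it comes from
      the additional \<open>\<beta> ^ (q ^ i)\<close> in \<open>nm_exp_num_z\<close>.\<close>
    have "nm (exp_num w i) \<le> \<beta> ^ (q ^ i - 1)"
    proof (cases "even i")
      case True
      have "nm (exp_num (z ^ q) i) \<le> (\<Prod>j<i. if j = 0 then \<beta> ^ (q ^ i - 1) else 1)"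
        unfolding nm_exp_num_conj using beta True beta_power_le_one
        by (intro prod_mono) auto
      also have "\<dots> = \<beta> ^ (q ^ i - 1)"
        using i by (subst prod.delta) auto
      finally show ?thesis using True by (simp add: w nm_exp_num_z)
    next
      case False
      have "nm (exp_num (z ^ q) i) * \<beta> ^ (q ^ i) \<le> 1 * (\<beta> ^ (q ^ i - 1) * 1)"
        unfolding p using beta nm_exp_num_conj_le_one by (intro mult_mono) auto
      then show ?thesis using False by (simp add: w nm_exp_num_z)
    qed
    then have "nm (exp_num w i) * (1 / \<beta>) ^ (q ^ i - 1) \<le> \<beta> ^ (q ^ i - 1) * (1 / \<beta>) ^ (q ^ i - 1)"
      using beta by (intro mult_right_mono) auto
    also have "\<dots> = 1" using beta by (simp add: power_one_over)
    finally show "nm (exp_num w i) * nm \<kappa> ^ (q ^ i - 1) \<le> 1" by (simp add: nm\<kappa>)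
  qed
  have zeroF: "scaled_exp (a + b * t) = 0" if "a \<in> F" "b \<in> F" for a b
    using sub[of a b] that F_in_A by (simp add: mult.commute)
  have injF: "a = 0 \<and> b = 0" if ab: "a \<in> F" "b \<in> F" "scaled_exp ((a + b * t) / x) = 0" for a b
  proof -
    have "nm (a + b * t) \<le> 1" using nm_combination_le[OF ab(1,2) nm_t_le] by simp
    then have "nm ((a + b * t) / x) \<le> \<beta>" using beta by (simp add: nm_x mult_left_le_one_le)
    then have "(a + b * t) / x = 0" using beta by (intro inj[OF ab(3)]) linarith
    then have "a + b * t = 0" using x_neq_0 by simp
    then show ?thesis using F_indep_t[OF ab(1,2)] by simp
  qed
  show "{\<mu>. scaled_exp \<mu> = 0} = ?L"
  proof (intro equalityI subsetI)
    fix \<mu> assume "\<mu> \<in> {\<mu>. scaled_exp \<mu> = 0}"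
    then have \<mu>: "scaled_exp \<mu> = 0" by simp
    show "\<mu> \<in> ?L"
    proof (rule scaled_exp_kernel_subset[where s = t, OF _ _ zeroF injF _ \<mu>])
      show "a + b * t + x * \<nu> \<in> ?L" if ab: "a \<in> F" "b \<in> F" "\<nu> \<in> ?L" for a b \<nu>
      proof -
        obtain c d where cd: "\<nu> = c + t * d" "c \<in> A" "d \<in> A" using ab(3) by blast
        have "a + b * t + x * \<nu> = (a + x * c) + t * (b + x * d)"
          by (simp add: cd algebra_simps)
        moreover have "a + x * c \<in> A" "b + x * d \<in> A"
          using F_in_A ab cd x_in_A by (auto intro!: A_add A_mult)
        ultimately show ?thesis by blast
      qed
      show "\<mu> \<in> ?L" if \<mu>: "scaled_exp \<mu> = 0" "nm \<mu> \<le> 1" for \<mu>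
      proof -
        obtain a b where ab: "a \<in> F" "b \<in> F" "scaled_exp ((\<mu> - (a + b * t)) / x) = 0"
          by (rule additive_descent[OF scaled_exp_diff scaled_exp_x x_neq_0 F_card F_diff zeroF injF \<mu>(1)])
        have "nm (\<mu> - (a + b * t)) \<le> 1"
          using nm_combination_le[OF ab(1,2) nm_t_le] \<mu>(2) by (intro nm_diff_le') auto
        then have "nm ((\<mu> - (a + b * t)) / x) \<le> \<beta>" using beta by (simp add: nm_x mult_left_le_one_le)
        then have "(\<mu> - (a + b * t)) / x = 0" using beta by (intro inj[OF ab(3)]) linarith
        then have "\<mu> = a + t * b" using x_neq_0 by (simp add: mult.commute)
        then show ?thesis using ab F_in_A by blast
      qed
      show "nm t \<le> 1 / \<beta>"
      proof -
        have "1 \<le> 1 / \<beta>" using beta by simp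
        then show ?thesis using nm_t_le by linarith
      qed
    qed
  qed (use sub in auto)
qed

end

end

section \<open>The period and the main theorem\<close>

context conjugate_places
begin

lemma power_q_power: "(u ^ (q ^ a)) ^ (q ^ b) = (u :: 'c) ^ (q ^ (a + b))"
  by (simp add: power_add flip: power_mult)

context
  fixes T Ts :: 'c
  assumes T: "T = 1 / (t - z ^ q)" and Ts: "Ts = 1 / (t - z)"
begin

lemma nm_T: "nm T = 1 / \<beta>" "nm Ts = 1"
  by (simp_all add: T Ts nm_t nm_t_z)

lemma T_nz: "T \<noteq> 0" "Ts \<noteq> 0"
  using nm_T beta by auto

lemma T_power: "T ^ (q ^ Suc j) = 1 / (t ^ (q ^ Suc j) - z ^ (q ^ j))"
  using z_power_cong[of "Suc (Suc j)" j]
  by (simp add: T power_divide frob_power_diff flip: power_mult del: power_Suc) (simp add: mult.assoc)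

lemma bracket_Suc: "bracket q T Ts (Suc j) = T ^ (q ^ Suc j) - 1 / (t - z ^ (q ^ j))"
  by (simp add: bracket_def z_power T Ts del: power_Suc)

lemma nm_bracket: "nm (bracket q T Ts (Suc j)) = (1 / \<beta>) ^ (q ^ Suc j)"
proof -
  have "nm (1 / (t - z ^ (q ^ j))) \<le> 1 / \<beta>"
    using nm_t_power_z[of 0 j] beta by simp
  also have "1 / \<beta> < (1 / \<beta>) ^ (q ^ Suc j)"
    using power_strict_increasing[of 1 "q ^ Suc j" "1 / \<beta>"] beta power_q_strict_mono[of 0 "Suc j"]
    by (simp del: power_Suc)
  finally have "nm (1 / (t - z ^ (q ^ j))) < nm (T ^ (q ^ Suc j))"
    by (simp add: nm_T del: nm_divide power_Suc)
  then show ?thesis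
    unfolding bracket_Suc by (subst nm_diff_eq) (simp_all add: nm_T del: power_Suc)
qed

lemma bracket_nz: "bracket q T Ts (Suc j) \<noteq> 0"
proof
  assume "bracket q T Ts (Suc j) = 0"
  then have "nm (bracket q T Ts (Suc j)) = 0" by simp
  then show False using beta unfolding nm_bracket by simp
qed

text \<open>In terms of r and s of the proof, the power of T is 1/r and the bracket is 1/r - 1/s =
  (s - r)/(r s). Thus B is the infinite product of the \<open>T^(q^j) / [j]\<close> over j \<ge>
  1.\<close>

lemma tail_factor_eq_bracket:
  "(t - z ^ (q ^ j)) / (t - t ^ (q ^ Suc j)) = T ^ (q ^ Suc j) / bracket q T Ts (Suc j)"
proof -
  define r s where "r = t ^ (q ^ Suc j) - z ^ (q ^ j)" and "s = t - z ^ (q ^ j)"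
  have "r \<noteq> 0" "s \<noteq> 0" "s - r \<noteq> 0"
    using t_power_neq_z[of "Suc j" j] t_power_neq_z[of 0 j] t_power_eq_iff[of 0 "Suc j"]
    by (simp_all add: r_def s_def del: power_Suc)
  then have "s / (s - r) = (1 / r) / (1 / r - 1 / s)"
    by (simp add: divide_simps)
  moreover have "s - r = t - t ^ (q ^ Suc j)" by (simp add: r_def s_def)
  ultimately show ?thesis
    unfolding bracket_Suc T_power by (simp add: r_def s_def del: power_Suc)
qed

text \<open>Indices of equal parity subtract the same element, so \<open>[n+2] - [n]\<close> is a
  difference of powers of T, namely the \<open>q ^ n\<close>-th power of [2].\<close>

lemma bracket_diff:
  "1 - bracket q T Ts (Suc i) / bracket q T Ts (Suc (i + 2)) =
    bracket q T Ts 2 ^ (q ^ Suc i) / bracket q T Ts (Suc (i + 2))"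
proof -
  have "bracket q T Ts (Suc (i + 2)) - bracket q T Ts (Suc i) = T ^ (q ^ Suc (i + 2)) - T ^ (q ^ Suc i)"
    using z_power_cong[of "i + 2" i] by (simp add: bracket_Suc del: power_Suc)
  also have "\<dots> = (T ^ (q ^ 2) - T) ^ (q ^ Suc i)"
    using power_q_power[of T 2 "Suc i"] by (simp add: frob_power_diff del: power_Suc)
  also have "T ^ (q ^ 2) - T = bracket q T Ts 2" by (simp add: bracket_def)
  finally show ?thesis
    using bracket_nz[of "i + 2"] by (simp add: diff_divide_eq_iff)
qed

abbreviation "period_factor i \<equiv> 1 - bracket q T Ts (i + 1) / bracket q T Ts (i + 3)"

lemma period_factor: "nm (period_factor i) = 1" "nm (period_factor i - 1) \<le> \<beta> ^ i"
proof -
  define \<delta> where "\<delta> = bracket q T Ts (i + 1) / bracket q T Ts (i + 3)"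
  have "2 \<le> q ^ 2" using q_ge_2 self_le_power[of q 2] by linarith
  then have "q ^ Suc i * 2 \<le> q ^ Suc i * q ^ 2" by (rule mult_le_mono2)
  then have le: "q ^ Suc i * 2 \<le> q ^ Suc (i + 2)" by (simp add: power2_eq_square mult_ac)
  have "nm \<delta> = (1 / \<beta>) ^ (q ^ Suc i) / (1 / \<beta>) ^ (q ^ Suc (i + 2))"
    using nm_bracket[of i] nm_bracket[of "i + 2"] by (simp add: \<delta>_def numeral_3_eq_3 del: power_Suc)
  also have "\<dots> = \<beta> ^ (q ^ Suc (i + 2) - q ^ Suc i)"
    using beta le by (simp add: power_one_over power_diff del: power_Suc)
  also have "\<dots> \<le> \<beta> ^ Suc i"
  proof -
    have "Suc i \<le> q ^ Suc i" using q_ge_2 self_le_ge2_pow by blast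
    then have "Suc i \<le> q ^ Suc (i + 2) - q ^ Suc i" using le by linarith
    then show ?thesis using beta by (intro power_decreasing) auto
  qed
  finally have \<delta>: "nm \<delta> \<le> \<beta> ^ Suc i" .
  also have "\<dots> < 1" by (rule beta_power_less_one) simp
  finally show "nm (period_factor i) = 1"
    unfolding \<delta>_def[symmetric] using nm_diff_eq[of \<delta> 1] by simp
  have "\<beta> ^ Suc i \<le> \<beta> ^ i" using beta by (intro power_decreasing) auto
  with \<delta> show "nm (period_factor i - 1) \<le> \<beta> ^ i"
    unfolding \<delta>_def[symmetric] by simp
qed

text \<open>Each factor is a factor of \<open>tail_prod\<close> times a power of u =
  \<open>[2] / T^(q^2)\<close>. The exponents of u add up to q + ... + q^n = (q^(n+1) - q)/(q - 1),
  so the (q-1)-th power leaves \<open>u^(q^(n+1))\<close>, which tends to 1, and the constant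
  \<open>u^(-q)\<close>.\<close>

lemma period_product:
  assumes B: "tail_prod \<longlonglongrightarrow> B"
  shows "convergent_prod period_factor" "prodinf period_factor \<noteq> 0"
    "prodinf period_factor ^ (q - 1) = B ^ (q - 1) * (bracket q T Ts 1 ^ (q - 1) * T ^ q / bracket q T Ts 2)"
proof -
  let ?c = "bracket q T Ts"
  have "(\<lambda>i. nm (period_factor i - 1)) \<longlonglongrightarrow> 0"
    using period_factor(2) beta
    by (intro tendsto_sandwich[OF _ _ tendsto_const LIMSEQ_power_zero[of \<beta>]] always_eventually allI)
      (simp_all del: nm_divide)
  then obtain L where L: "(\<lambda>n. \<Prod>i<n. period_factor i) \<longlonglongrightarrow> L" "nm L = 1"
    using tendsto_prod_unit[of period_factor] period_factor(1) by blast
  then have "L \<noteq> 0" by auto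
  from prodinf_eq_limit[OF L(1) this]
  show "convergent_prod period_factor" "prodinf period_factor \<noteq> 0"
    using \<open>L \<noteq> 0\<close> by simp_all
  have nz: "?c 1 \<noteq> 0" "?c 2 \<noteq> 0"
    using bracket_nz[of 0] bracket_nz[of 1] by (simp_all add: numeral_2_eq_2)
  \<comment> \<open>C removes the first two factors of \<open>tail_prod\<close>, which have no
    counterpart in the product of the period, and contains the constant \<open>u^(-q)\<close>. The
    case n = 0 below verifies its value.\<close>
  define C where "C = ?c 1 ^ (q - 1) * T ^ q / ?c 2"
  define u where "u = ?c 2 / T ^ (q ^ 2)"
  have tail_Suc: "tail_prod (Suc k) = tail_prod k * (T ^ (q ^ Suc k) / ?c (Suc k))" for k
    unfolding tail_prod_def by (simp add: tail_factor_eq_bracket del: power_Suc)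
  have partial: "(\<Prod>i<n. period_factor i) ^ (q - 1) = tail_prod (n + 2) ^ (q - 1) * C * u ^ (q ^ Suc n)" for n
  proof (induction n)
    case 0
    have "tail_prod 2 = T ^ q / ?c 1 * (T ^ (q ^ 2) / ?c 2)"
      using tail_Suc[of 0] tail_Suc[of 1] by (simp add: numeral_2_eq_2 tail_prod_def)
    moreover have "(T ^ q / ?c 1 * (T ^ (q ^ 2) / ?c 2)) ^ (q - 1) * C * u ^ q = 1"
    proof -
      have 1: "?c 2 ^ q = ?c 2 ^ (q - 1) * ?c 2" by (metis power_minus_mult q_pos)
      have "(T ^ q) ^ (q - 1) * T ^ q = (T ^ q) ^ q" "(T ^ (q ^ 2)) ^ q = (T ^ (q ^ 2)) ^ (q - 1) * T ^ (q ^ 2)"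
        by (metis power_minus_mult q_pos)+
      moreover have "(T ^ q) ^ q = T ^ (q ^ 2)" by (simp add: power2_eq_square power_mult)
      ultimately show ?thesis
        using nz T_nz by (simp add: C_def u_def 1 power_divide power_mult_distrib divide_simps)
    qed
    ultimately show ?case by (simp add: numeral_2_eq_2)
  next
    case (Suc n)
    have f: "period_factor n = ?c 2 ^ (q ^ Suc n) / ?c (Suc (n + 2))"
      using bracket_diff[of n] by (simp add: eval_nat_numeral)
    have "?c 2 ^ (q ^ Suc n) = u ^ (q ^ Suc n) * T ^ (q ^ Suc (n + 2))"
    proof -
      have "(T ^ (q ^ 2)) ^ (q ^ Suc n) = T ^ (q ^ Suc (n + 2))"
        using power_q_power[of T 2 "Suc n"] by (simp del: power_Suc)
      then show ?thesis using T_nz by (simp add: u_def power_divide del: power_Suc)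
    qed
    then have "period_factor n = u ^ (q ^ Suc n) * (T ^ (q ^ Suc (n + 2)) / ?c (Suc (n + 2)))"
      unfolding f by simp
    then have "(\<Prod>i<Suc n. period_factor i) ^ (q - 1) =
        tail_prod (n + 2) ^ (q - 1) * C * u ^ (q ^ Suc n) *
        ((u ^ (q ^ Suc n)) ^ (q - 1) * (T ^ (q ^ Suc (n + 2)) / ?c (Suc (n + 2))) ^ (q - 1))"
      unfolding prod.lessThan_Suc power_mult_distrib Suc.IH by (simp only: power_mult_distrib)
    also have "\<dots> = tail_prod (Suc (n + 2)) ^ (q - 1) * C * ((u ^ (q ^ Suc n)) ^ (q - 1) * u ^ (q ^ Suc n))"
      unfolding tail_Suc power_mult_distrib by (simp only: mult_ac)
    also have "(u ^ (q ^ Suc n)) ^ (q - 1) * u ^ (q ^ Suc n) = u ^ (q ^ Suc (Suc n))"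
      by (metis power_minus_mult q_pos power_mult power_Suc2)
    finally show ?case by (simp only: add_Suc)
  qed
  have u: "(\<lambda>n. u ^ (q ^ Suc n)) \<longlonglongrightarrow> 1"
  proof -
    define \<delta> where "\<delta> = T / T ^ (q ^ 2)"
    have "u = 1 - \<delta>" using T_nz by (simp add: u_def \<delta>_def bracket_def diff_divide_distrib)
    have "2 \<le> q ^ 2" using q_ge_2 self_le_power[of q 2] by linarith
    then have "(1 / \<beta>) ^ 1 < (1 / \<beta>) ^ (q ^ 2)" using beta by (intro power_strict_increasing) auto
    then have "nm \<delta> < 1" using beta by (simp add: \<delta>_def nm_T divide_less_eq mult.commute)
    have le: "nm (u ^ (q ^ Suc n) - 1) \<le> nm \<delta> ^ n" for n
    proof -
      have "u ^ (q ^ Suc n) - 1 = - (\<delta> ^ (q ^ Suc n))"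
        unfolding \<open>u = 1 - \<delta>\<close> frob_power_diff by simp
      then have "nm (u ^ (q ^ Suc n) - 1) = nm \<delta> ^ (q ^ Suc n)" by (simp del: power_Suc)
      also have "\<dots> \<le> nm \<delta> ^ n"
        using \<open>nm \<delta> < 1\<close> q_ge_2 self_le_ge2_pow[of q "Suc n"] by (intro power_decreasing) auto
      finally show ?thesis .
    qed
    show ?thesis
      by (rule nm_bounded_tendsto[OF _ le]) (use \<open>nm \<delta> < 1\<close> in \<open>simp add: LIMSEQ_power_zero\<close>)
  qed
  have "(\<lambda>n. tail_prod (n + 2)) \<longlonglongrightarrow> B" using B by (rule LIMSEQ_ignore_initial_segment)
  then have "(\<lambda>n. tail_prod (n + 2) ^ (q - 1) * C * u ^ (q ^ Suc n)) \<longlonglongrightarrow> B ^ (q - 1) * C * 1"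
    by (intro tendsto_mult_nm tendsto_power_nm u tendsto_const)
  moreover have "(\<lambda>n. (\<Prod>i<n. period_factor i) ^ (q - 1)) \<longlonglongrightarrow> L ^ (q - 1)"
    by (rule tendsto_power_nm[OF L(1)])
  ultimately have "L ^ (q - 1) = B ^ (q - 1) * C"
    unfolding partial using LIMSEQ_unique by fastforce
  then show "prodinf period_factor ^ (q - 1) = B ^ (q - 1) * (?c 1 ^ (q - 1) * T ^ q / ?c 2)"
    using prodinf_eq_limit(2)[OF L(1) \<open>L \<noteq> 0\<close>] by (simp add: C_def)
qed

text \<open>The prefactors of \<xi> cancel both brackets. The result says that
  \<open>B * Ts / \<xi>\<close> is a (q-1)-th root of -1/T, as the exponential of Psi requires of
  its \<eta>.\<close>

lemma period_power:
  assumes B: "tail_prod \<longlonglongrightarrow> B"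
    and rho: "\<rho> ^ (q - 1) = - bracket q T Ts 2"
    and xi: "\<xi> = \<rho> * (Ts / T) / bracket q T Ts 1 * prodinf period_factor"
  shows "\<xi> \<noteq> 0" "\<xi> ^ (q - 1) = - T * (B * Ts) ^ (q - 1)"
proof -
  let ?c = "bracket q T Ts"
  have nz: "?c 1 \<noteq> 0" "?c 2 \<noteq> 0"
    using bracket_nz[of 0] bracket_nz[of 1] by (simp_all add: numeral_2_eq_2)
  have "\<rho> \<noteq> 0"
  proof
    assume "\<rho> = 0"
    then have "\<rho> ^ (q - 1) = 0" using q_ge_2 by (simp add: power_0_left)
    then show False using rho nz by (metis neg_equal_0_iff_equal)
  qed
  then show "\<xi> \<noteq> 0" using nz T_nz period_product(2)[OF B] by (simp add: xi)
  have Tq: "T ^ q = T ^ (q - 1) * T" by (metis power_minus_mult q_pos)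
  have "\<xi> ^ (q - 1) = - ?c 2 * (Ts / T) ^ (q - 1) / ?c 1 ^ (q - 1) *
      (B ^ (q - 1) * (?c 1 ^ (q - 1) * T ^ q / ?c 2))"
    unfolding xi power_mult_distrib power_divide rho period_product(3)[OF B] ..
  also have "\<dots> = - T * (B * Ts) ^ (q - 1)"
    unfolding Tq using nz T_nz by (simp add: power_divide power_mult_distrib divide_simps)
  finally show "\<xi> ^ (q - 1) = - T * (B * Ts) ^ (q - 1)" .
qed

end

end

context constant_field
begin

text \<open>Written out, pi(t) * x = 1 is the relation \<open>rel\<close> between x, y and t * y,
  with trace and norm of zeta in F as coefficients. Multiplied by v it expresses v through v * x and
  v * y; solved for t * y it shows that t * y is in A.\<close>

lemma inverse_ideal_eq:
  assumes tr: "z + z ^ q \<in> F" and norm: "z * z ^ q \<in> F"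
  shows "inverse_ideal (fraction_subfield (adjoin F {t})) A (ideal_gen2 A x (t * x)) =
    {a + t * b | a b. a \<in> A \<and> b \<in> A}" (is "inverse_ideal ?K A ?I = ?L")
proof (intro equalityI subsetI)
  note add = adjoin.add[of _ F "{x, t * x}", folded A_def]
    and mult = adjoin.mult[of _ F "{x, t * x}", folded A_def]
  have scal: "a \<in> A" if "a \<in> F" for a
    unfolding A_def using that by (rule adjoin.scalar)
  have gens: "x \<in> A" "t * x \<in> A" by (auto simp: A_def intro: adjoin.gen)
  have rel: "t * (t * x) - (z + z ^ q) * (t * x) + (z * z ^ q) * x = 1"
  proof -
    have "t * (t * x) - (z + z ^ q) * (t * x) + (z * z ^ q) * x = (t - z) * (t - z ^ q) * x"
      by (simp add: algebra_simps)
    also have "\<dots> = 1" using x_neq_0 by (simp add: x_def)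
    finally show ?thesis .
  qed
  {
    fix v assume "v \<in> inverse_ideal ?K A ?I"
    moreover have "x \<in> ?I" "t * x \<in> ?I"
      unfolding ideal_gen2_def using scal[OF F_0] scal[OF F_1] by force+
    ultimately have v: "v * x \<in> A" "v * (t * x) \<in> A" by (auto simp: inverse_ideal_def)
    have "v = (z * z ^ q * (v * x) + - (z + z ^ q) * (v * (t * x))) + t * (v * (t * x))"
    proof -
      have "v = v * (t * (t * x) - (z + z ^ q) * (t * x) + (z * z ^ q) * x)" by (simp only: rel mult_1_right)
      then show ?thesis by (simp add: algebra_simps)
    qed
    moreover have "z * z ^ q * (v * x) + - (z + z ^ q) * (v * (t * x)) \<in> A"
      by (intro add mult scal norm F_minus[OF tr] v)
    ultimately show "v \<in> ?L" using v by blast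
  next
    fix v assume "v \<in> ?L"
    then obtain a b where v: "v = a + t * b" "a \<in> A" "b \<in> A" by blast
    have R1: "a \<in> adjoin F {t}" if "a \<in> F" for a using that by (rule adjoin.scalar)
    have Rt: "t \<in> adjoin F {t}" by (rule adjoin.gen) simp
    have KR: "r \<in> ?K" if "r \<in> adjoin F {t}" for r
      unfolding fraction_subfield_def
      by (rule CollectI, rule exI[of _ r], rule exI[of _ 1]) (use that R1[OF F_1] in simp)
    have K_mult: "u * w \<in> ?K" if uw: "u \<in> ?K" "w \<in> ?K" for u w
    proof -
      obtain a b c d where ab: "u = a / b" "w = c / d" "b \<noteq> 0" "d \<noteq> 0"
        and R: "a \<in> adjoin F {t}" "b \<in> adjoin F {t}" "c \<in> adjoin F {t}" "d \<in> adjoin F {t}"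
        using uw unfolding fraction_subfield_def by blast
      have "u * w = (a * c) / (b * d)" using ab by simp
      moreover have "a * c \<in> adjoin F {t}" "b * d \<in> adjoin F {t}" using R by (auto intro: adjoin.mult)
      moreover have "b * d \<noteq> 0" using ab by simp
      ultimately show ?thesis unfolding fraction_subfield_def by blast
    qed
    have K_add: "u + w \<in> ?K" if uw: "u \<in> ?K" "w \<in> ?K" for u w
    proof -
      obtain a b c d where ab: "u = a / b" "w = c / d" "b \<noteq> 0" "d \<noteq> 0"
        and R: "a \<in> adjoin F {t}" "b \<in> adjoin F {t}" "c \<in> adjoin F {t}" "d \<in> adjoin F {t}"
        using uw unfolding fraction_subfield_def by blast
      have "u + w = (a * d + c * b) / (b * d)" using ab by (simp add: add_frac_eq)
      moreover have "a * d + c * b \<in> adjoin F {t}" "b * d \<in> adjoin F {t}"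
        using R by (auto intro: adjoin.mult adjoin.add)
      moreover have "b * d \<noteq> 0" using ab by simp
      ultimately show ?thesis unfolding fraction_subfield_def by blast
    qed
    have xK: "x \<in> ?K"
    proof -
      have "(t - z) * (t - z ^ q) = t * t + (- (z + z ^ q) * t + z * z ^ q)"
        by (simp add: algebra_simps)
      moreover have "t * t + (- (z + z ^ q) * t + z * z ^ q) \<in> adjoin F {t}"
        by (intro adjoin.add adjoin.mult Rt R1 norm F_minus[OF tr])
      ultimately have "(t - z) * (t - z ^ q) \<in> adjoin F {t}" by simp
      moreover have "(t - z) * (t - z ^ q) \<noteq> 0" using x_neq_0 by (auto simp: x_def)
      ultimately show ?thesis
        unfolding fraction_subfield_def x_def using R1[OF F_1] by blast
    qed
    have AK: "a \<in> ?K" if "a \<in> A" for a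
      using that unfolding A_def
    proof (induction rule: adjoin.induct)
      case (scalar a)
      then show ?case using KR R1 by blast
    next
      case (gen a)
      then show ?case using xK K_mult[OF KR[OF Rt] xK] by auto
    qed (auto intro: K_add K_mult)
    have ty: "t * (t * x) \<in> A"
    proof -
      have "t * (t * x) = 1 + ((z + z ^ q) * (t * x) + - (z * z ^ q) * x)"
        using rel by (simp add: algebra_simps)
      also have "\<dots> \<in> A"
        by (intro add mult scal F_1 tr F_minus[OF norm] gens)
      finally show ?thesis .
    qed
    have "v * w \<in> A" if w: "w \<in> ?I" for w
    proof -
      obtain c d where cd: "w = c * x + d * (t * x)" "c \<in> A" "d \<in> A"
        using w unfolding ideal_gen2_def by blast
      have "v * w = a * c * x + (a * d * (t * x) + (b * c * (t * x) + b * d * (t * (t * x))))"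
        by (simp add: v cd algebra_simps)
      also have "\<dots> \<in> A"
        by (intro add mult[OF _ ty] mult[OF _ gens(1)] mult[OF _ gens(2)]) (auto intro: mult v cd)
      finally show ?thesis .
    qed
    moreover have "v \<in> ?K"
      unfolding v using v AK KR[OF Rt] by (intro K_add K_mult) auto
    ultimately show "v \<in> inverse_ideal ?K A ?I" by (simp add: inverse_ideal_def)
  }
qed

end

section \<open>Finite fields and constants inside the completed algebraic closure\<close>

lemma field_power_CARD:
  fixes a :: "'k::{field, finite}"
  shows "a ^ CARD('k) = a"
proof (cases "a = 0")
  case False
  have "(\<Prod>b\<in>UNIV - {0}. a * b) = (\<Prod>b\<in>UNIV - {0}. b)"
    by (rule prod.reindex_bij_witness[of _ "\<lambda>b. b / a" "\<lambda>b. a * b"]) (use False in auto)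
  then have "a ^ (CARD('k) - 1) * \<Prod>(UNIV - {0 :: 'k}) = \<Prod>(UNIV - {0})"
    by (simp add: prod.distrib)
  then have "a ^ (CARD('k) - 1) = 1" by simp
  then show ?thesis
    by (metis finite_UNIV_card_ge_0 finite mult_1_left power_minus_mult)
qed (simp add: finite_UNIV_card_ge_0)

text \<open>The lower bound comes from the trace \<open>a ^ q + a\<close>: it maps the
  \<open>q^2\<close> elements into the fixed field, and each fibre has at most q elements as the
  root set of a polynomial of degree q.\<close>

lemma card_Fq:
  assumes card: "CARD('k::{field, finite}) = q\<^sup>2" and q: "2 \<le> q"
    and frob: "\<And>u v :: 'k. (u + v) ^ q = u ^ q + v ^ q"
  shows "card (Fq q :: 'k set) = q"
proof -
  have roots: "card {a. a ^ q + c * a = (d :: 'k)} \<le> q" for c d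
  proof -
    define P where "P = Polynomial.monom 1 q + [:- d, c:]"
    have "Polynomial.degree P \<le> q"
      unfolding P_def using q by (intro degree_add_le degree_monom_le) auto
    moreover have "poly.coeff P q = 1"
      using q by (simp add: P_def coeff_eq_0)
    then have "P \<noteq> 0" by auto
    moreover have "poly P a = (a ^ q + c * a) - d" for a
      by (simp add: P_def poly_monom algebra_simps)
    then have "{a. a ^ q + c * a = d} = {a. poly P a = 0}" by simp
    ultimately show ?thesis using card_poly_roots_bound[of P] by simp
  qed
  have "Fq q = {a :: 'k. a ^ q + (- 1) * a = 0}" by (auto simp: Fq_def)
  then have le: "card (Fq q :: 'k set) \<le> q" using roots[of "- 1" 0] by simp
  have "(UNIV :: 'k set) = (\<Union>d\<in>Fq q. {a. a ^ q + 1 * a = d})"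
  proof -
    have "a ^ q + a \<in> Fq q" for a :: 'k
      using field_power_CARD[of a] by (simp add: Fq_def frob card power2_eq_square power_mult add.commute)
    then show ?thesis by auto
  qed
  then have "q\<^sup>2 \<le> (\<Sum>d\<in>(Fq q :: 'k set). card {a. a ^ q + 1 * a = d})"
    unfolding card[symmetric] by (metis card_UN_le finite)
  also have "\<dots> \<le> (\<Sum>d\<in>(Fq q :: 'k set). q)" by (intro sum_mono roots)
  finally have "q * q \<le> card (Fq q :: 'k set) * q" by (simp add: power2_eq_square)
  then have "q \<le> card (Fq q :: 'k set)" using q by simp
  with le show ?thesis by simp
qed

lemma frobenius_power_add:
  assumes q: "q = p ^ n" and p: "Factorial_Ring.prime p" and char: "of_nat p = (0 :: 'a::idom)"
  shows "(u + v :: 'a) ^ q = u ^ q + v ^ q"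
proof -
  have "CHAR('a) dvd p" using char by (simp add: of_nat_eq_0_iff_char_dvd)
  moreover have "CHAR('a) \<noteq> 1" by simp
  ultimately have "CHAR('a) = p" using p unfolding prime_nat_iff by blast
  then show ?thesis using freshmans_dream'[of q n u v] p q by simp
qed

lemma of_nat_prime_eq_0:
  assumes "CARD('k::{field, finite}) = p ^ n" "Factorial_Ring.prime p"
  shows "of_nat p = (0 :: 'k)"
proof -
  have "Factorial_Ring.prime CHAR('k)"
    using prime_CHAR_semidom[where ?'a = 'k] finite_imp_CHAR_pos[where ?'a = 'k] by simp
  moreover have "CHAR('k) dvd p ^ n" using CHAR_dvd_CARD[where ?'a = 'k] assms by simp
  ultimately have "CHAR('k) dvd p" by (rule prime_dvd_power_nat)
  then show ?thesis by (simp add: of_nat_eq_0_iff_char_dvd)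
qed

lemma is_completed_alg_closureD:
  assumes "is_completed_alg_closure \<iota>"
  shows "ultrametric_field (\<lambda>u::'c::{field, complete_space}. dist u 0)"
    and "\<iota> 1 = 1" and "\<iota> (u + v) = \<iota> u + \<iota> v" and "\<iota> (u * v) = \<iota> u * \<iota> v" and "\<iota> 0 = (0 :: 'c)"
proof -
  show one: "\<iota> 1 = 1" and add: "\<iota> (u + v) = \<iota> u + \<iota> v" and "\<iota> (u * v) = \<iota> u * \<iota> v" for u v
    using assms unfolding is_completed_alg_closure_def by blast+
  have "\<iota> 0 + \<iota> 0 = \<iota> 0 + 0" using add[of 0 0] by (simp only: add_0_right)
  then show "\<iota> 0 = 0" by (simp only: add_left_cancel)
  show "ultrametric_field (\<lambda>u::'c. dist u 0)"
  proof
    show "dist u v = dist (u - v) 0" and "dist (u * v) 0 = dist u 0 * dist v 0"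
      and "dist (u + v) 0 \<le> max (dist u 0) (dist v 0)" for u v :: 'c
      using assms unfolding is_completed_alg_closure_def by blast+
  qed
qed

lemma const_embed_hom:
  assumes "is_completed_alg_closure (\<iota> :: 'k::field fls alg_closure \<Rightarrow> 'c::{field, complete_space})"
  shows "const_embed \<iota> 0 = 0" "const_embed \<iota> 1 = 1"
    "const_embed \<iota> (a + b) = const_embed \<iota> a + const_embed \<iota> b"
    "const_embed \<iota> (a * b) = const_embed \<iota> a * const_embed \<iota> b"
    "const_embed \<iota> (a - b) = const_embed \<iota> a - const_embed \<iota> b"
    "const_embed \<iota> (a ^ n) = const_embed \<iota> a ^ n"
    "const_embed \<iota> (of_nat n) = of_nat n"
proof -
  note hom = is_completed_alg_closureD[OF assms]
  show 0: "const_embed \<iota> 0 = 0" and 1: "const_embed \<iota> 1 = 1" by (simp_all add: const_embed_def hom)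
  show add: "const_embed \<iota> (a + b) = const_embed \<iota> a + const_embed \<iota> b" for a b
    by (simp add: const_embed_def hom flip: fls_plus_const)
  show mult: "const_embed \<iota> (a * b) = const_embed \<iota> a * const_embed \<iota> b" for a b
    by (simp add: const_embed_def hom flip: fls_const_mult_const)
  show "const_embed \<iota> (a - b) = const_embed \<iota> a - const_embed \<iota> b"
    using add[of "a - b" b] by simp
  show "const_embed \<iota> (a ^ n) = const_embed \<iota> a ^ n"
    by (induction n) (simp_all add: 1 mult)
  show "const_embed \<iota> (of_nat n) = of_nat n"
    by (induction n) (simp_all add: 0 1 add)
qed

lemma is_completed_alg_closure_abs:
  assumes "is_completed_alg_closure (\<iota> :: 'k::field fls alg_closure \<Rightarrow> 'c::{field, complete_space})"
  obtains b where "1 < b" "dist (\<iota> (to_ac (inverse fls_X))) 0 = b"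
    "\<And>a. a \<noteq> 0 \<Longrightarrow> dist (const_embed \<iota> a) 0 = 1"
proof -
  obtain b where b: "1 < b" "\<And>f. f \<noteq> 0 \<Longrightarrow> dist (\<iota> (to_ac f)) 0 = b powi (- fls_subdegree f)"
    using assms unfolding is_completed_alg_closure_def by blast
  have "dist (\<iota> (to_ac (inverse fls_X))) 0 = b powi (- fls_subdegree (inverse (fls_X :: 'k fls)))"
    by (intro b(2)) simp
  then have "dist (\<iota> (to_ac (inverse fls_X))) 0 = b" by simp
  moreover have "dist (const_embed \<iota> a) 0 = 1" if "a \<noteq> 0" for a
    unfolding const_embed_def using that by (subst b(2)) simp_all
  ultimately show ?thesis using b(1) that by blast
qed

theorem theorem3p16:
  fixes q :: nat
    and \<zeta> :: "'k::{field, finite}"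
    and \<iota> :: "'k fls alg_closure \<Rightarrow> 'c::{field, complete_space}"
    and \<Psi> \<Psi>s :: "'c \<Rightarrow> 'c poly"
    and z T t Ts p x y \<rho> l \<xi> :: 'c
    and F K A I :: "'c set"
  assumes q: "primepow q"
    and card: "CARD('k) = q\<^sup>2"
    and zeta: "\<zeta> \<notin> Fq q"
    and Cinf: "is_completed_alg_closure \<iota>"
    and z: "z = const_embed \<iota> \<zeta>"
    and T: "T = \<iota> (to_ac (inverse fls_X))"
    and t: "t = z ^ q + 1 / T"
    and Ts: "Ts = 1 / (t - z)"
    and p: "p = (t - z) * (t - z ^ q)"
    and x: "x = 1 / p"
    and y: "y = t / p"
    and F: "F = const_embed \<iota> ` Fq q"
    and K: "K = fraction_subfield (adjoin F {t})"
    and A: "A = adjoin F {x, y}"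
    and I: "I = ideal_gen2 A x y"
    and Psi: "drinfeld_module q F A \<Psi>"
    and Psi_x: "\<Psi> x = [: x, Ts + T ^ (q - 1) * Ts, Ts / T :]"
    and Psi_y: "\<Psi> y = [: y, t * Ts + z * T ^ (q - 1) * Ts, z * (Ts / T) :]"
    and Psis: "drinfeld_module q F A \<Psi>s"
    and Psis_x: "\<Psi>s x = [: x, T + Ts ^ (q - 1) * T, T / Ts :]"
    and Psis_y: "\<Psi>s y = [: y, t * T + z ^ q * Ts ^ (q - 1) * T, z ^ q * (T / Ts) :]"
    and rho: "\<rho> ^ (q - 1) = - bracket q T Ts 2"
    and ell: "l ^ (q - 1) = Ts / T"
    and xi: "\<xi> = \<rho> * (Ts / T) / bracket q T Ts 1 *
               (\<Prod>i. 1 - bracket q T Ts (i + 1) / bracket q T Ts (i + 3))"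
  shows "convergent_prod (\<lambda>i. 1 - bracket q T Ts (i + 1) / bracket q T Ts (i + 3)) \<and>
         period_lattice q A \<Psi> = (\<lambda>a. \<xi> * a) ` A \<and>
         period_lattice q A \<Psi>s = (\<lambda>a. T * l * \<xi> * a) ` inverse_ideal K A I"
proof -
  define nm where "nm u = dist u 0" for u :: 'c
  note hom = const_embed_hom[OF Cinf]
  interpret ultrametric_field nm
    using is_completed_alg_closureD(1)[OF Cinf] by (simp add: nm_def[abs_def])
  obtain b where b: "1 < b" "nm T = b" and nm_const: "\<And>a. a \<noteq> 0 \<Longrightarrow> nm (const_embed \<iota> a) = 1"
    using is_completed_alg_closure_abs[OF Cinf] unfolding nm_def T by metis
  obtain r n where r: "Factorial_Ring.prime r" "0 < n" "q = r ^ n"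
    using q unfolding primepow_def by blast
  have q2: "2 \<le> q"
    using r prime_ge_2_nat[OF r(1)] self_le_power[of r n] by linarith
  have "CARD('k) = r ^ (n * 2)" by (simp add: card r(3) power_mult)
  then have r0: "of_nat r = (0 :: 'k)" by (rule of_nat_prime_eq_0[OF _ r(1)])
  then have "of_nat r = (0 :: 'c)" using hom(7)[of r] by (simp add: hom)
  note frob_c = frobenius_power_add[OF r(3,1) this] and frob_k = frobenius_power_add[OF r(3,1) r0]
  have period: "a ^ q ^ 2 = a" for a :: 'k using field_power_CARD[of a] by (simp add: card)
  have conj: "\<zeta> ^ q - \<zeta> \<noteq> 0" using zeta by (simp add: Fq_def)
  have T0: "T \<noteq> 0" using b by auto
  have tz: "t - z ^ q = 1 / T" by (simp add: t)

  interpret conjugate_places nm q z t "1 / b"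
  proof
    show "2 \<le> q" by (rule q2)
    show "(u + v :: 'c) ^ q = u ^ q + v ^ q" for u v by (rule frob_c)
    show "z ^ q ^ 2 = z" using period[of \<zeta>] hom(6)[of \<zeta> "q ^ 2"] by (simp add: z)
    show "nm z \<le> 1" using nm_const[of \<zeta>] by (cases "\<zeta> = 0") (simp_all add: z hom)
    show "nm (z ^ q - z) = 1" using nm_const[OF conj] by (simp add: z hom)
    show "nm (t - z ^ q) = 1 / b" by (simp add: tz b)
    show "0 < 1 / b" "1 / b < 1" using b by simp_all
  qed

  interpret cf: constant_field nm q z t "1 / b" F
  proof
    show "a ^ q = a" if "a \<in> F" for a
      using that hom(6) by (auto simp: F Fq_def simp flip: hom(6))
    have "inj (const_embed \<iota>)"
    proof (rule injI)
      fix a c assume "const_embed \<iota> a = const_embed \<iota> c"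
      then have "nm (const_embed \<iota> (a - c)) = 0" by (simp add: hom)
      then show "a = c" using nm_const[of "a - c"] by auto
    qed
    then have "card F = card (Fq q :: 'k set)"
      unfolding F by (intro card_image) (auto intro: inj_on_subset)
    then show "card F = q" using card_Fq[OF card q2 frob_k] by simp
    show "1 \<in> F" unfolding F by (rule image_eqI[of _ _ 1]) (simp_all add: hom Fq_def)
    have diff_k: "(u - v) ^ q = u ^ q - v ^ q" for u v :: 'k
      using frob_k[of "u - v" v] by (simp add: eq_diff_eq)
    show "a - c \<in> F" if "a \<in> F" "c \<in> F" for a c
      using that unfolding F by (auto simp: Fq_def diff_k simp flip: hom(5) intro!: imageI)
    show "a = 0 \<and> c = 0" if ac: "a \<in> F" "c \<in> F" "nm (a + c * z ^ q) < 1" for a c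
    proof -
      obtain u v where uv: "a = const_embed \<iota> u" "c = const_embed \<iota> v" "u ^ q = u" "v ^ q = v"
        using ac(1,2) by (auto simp: F Fq_def)
      have "nm (const_embed \<iota> (u + v * \<zeta> ^ q)) < 1"
        using ac(3) by (simp add: uv z hom)
      then have *: "u + v * \<zeta> ^ q = 0" using nm_const[of "u + v * \<zeta> ^ q"] by auto
      \<comment> \<open>Frobenius gives the conjugate relation; subtracting the two isolates v times
        \<open>\<zeta> ^ q - \<zeta>\<close>.\<close>
      then have "(u + v * \<zeta> ^ q) ^ q = 0" using q2 by (simp add: zero_power)
      then have "u + v * \<zeta> = 0"
        using period[of \<zeta>] by (simp add: frob_k power_mult_distrib uv power2_eq_square power_mult)
      moreover have "v * (\<zeta> ^ q - \<zeta>) = (u + v * \<zeta> ^ q) - (u + v * \<zeta>)" by (simp add: algebra_simps)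
      ultimately have "v * (\<zeta> ^ q - \<zeta>) = 0" using * by simp
      then have "v = 0" using conj by simp
      then show ?thesis using * by (simp add: uv hom)
    qed
  qed

  have Fq_embed: "const_embed \<iota> a \<in> F" if "a ^ q = a" for a
    unfolding F Fq_def using that by blast
  have tr: "z + z ^ q \<in> F" and norm: "z * z ^ q \<in> F"
  proof -
    have "(\<zeta> ^ q) ^ q = \<zeta>" using period[of \<zeta>] by (simp add: power2_eq_square power_mult)
    then have "const_embed \<iota> (\<zeta> + \<zeta> ^ q) \<in> F" "const_embed \<iota> (\<zeta> * \<zeta> ^ q) \<in> F"
      by (auto intro!: Fq_embed simp: frob_k power_mult_distrib add.commute mult.commute)
    then show "z + z ^ q \<in> F" "z * z ^ q \<in> F" by (simp_all add: z hom)
  qed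

  have x_eq: "cf.x = x" by (simp add: cf.x_def x p)
  have y_eq: "t * x = y" by (simp add: x y)
  have A_eq: "cf.A = A" by (simp add: cf.A_def x_eq y_eq A)
  have x_swap: "1 / ((t - z ^ q) * (t - z)) = x" and x_noswap: "1 / ((t - z) * (t - z ^ q)) = x"
    by (simp_all add: x p mult.commute)
  have T_eq: "T = 1 / (t - z ^ q)" by (simp add: tz)
  have Ts0: "Ts \<noteq> 0" using T_nz[OF T_eq Ts] by simp
  obtain B where B: "tail_prod \<longlonglongrightarrow> B" "nm B = 1"
    using tail_prod_convergent by blast
  have B0: "B \<noteq> 0" using B(2) by auto
  have xi0: "\<xi> \<noteq> 0" and xi_power: "\<xi> ^ (q - 1) = - T * (B * Ts) ^ (q - 1)"
    using period_power[OF T_eq Ts B(1) rho xi] by blast+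
  have l0: "l \<noteq> 0"
  proof
    assume "l = 0"
    then have "l ^ (q - 1) = 0" using q2 by (simp add: power_0_left)
    then have "Ts / T = 0" using ell by metis
    then show False using T0 Ts0 by simp
  qed
  \<comment> \<open>Uniqueness of the coefficients applies at x, whose absolute value is that of T
    and so exceeds 1.\<close>
  have lattice: "period_lattice q A \<phi> = {v. (\<Sum>j. c j * v ^ (q ^ j)) = 0}"
    if "is_exp_coeffs q A \<phi> c" "poly.coeff (\<phi> x) 0 = x" for \<phi> c
  proof -
    have "x \<in> A" unfolding A by (rule adjoin.gen) simp
    moreover have "1 < nm x" using cf.nm_x b by (simp add: x_eq)
    ultimately show ?thesis
      unfolding period_lattice_def using drinfeld_exp_eq[OF that(1) _ that(2)] by simp
  qed

  \<comment> \<open>This is \<kappa>/\<xi> for the \<kappa> of \<open>kernel_conj\<close>; the value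
    of \<open>\<xi> ^ (q - 1)\<close> makes it admissible in \<open>exp_coeffs\<close>.\<close>
  define \<eta> where "\<eta> = B / (t - z) / \<xi>"
  have eta: "\<eta> ^ (q - 1) = - (t - z ^ q)"
  proof -
    have "\<eta> = B * Ts / \<xi>" by (simp add: \<eta>_def Ts)
    then have "\<eta> ^ (q - 1) = (B * Ts) ^ (q - 1) / (- T * (B * Ts) ^ (q - 1))"
      by (simp only: power_divide xi_power)
    then show ?thesis using B0 Ts0 by (simp add: tz)
  qed
  have "is_exp_coeffs q A \<Psi> (\<lambda>i. exp_num (z ^ q) i * \<eta> ^ (q ^ i - 1))"
    using exp_coeffs[of "z ^ q" z \<eta> F \<Psi>] Psi Psi_x Psi_y eta cf.F_frob
    unfolding x_swap T_eq[symmetric] Ts[symmetric] y_eq A by blast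
  then have Psi_exp: "is_exp_coeffs q cf.A \<Psi> (\<lambda>i. exp_num (z ^ q) i * (B / (t - z) / \<xi>) ^ (q ^ i - 1))"
    unfolding \<eta>_def A_eq .
  have lattice_Psi: "period_lattice q A \<Psi> = (\<lambda>a. \<xi> * a) ` A"
    using cf.kernel_conj[OF _ _ xi0 Psi_exp _ refl refl B] lattice[OF Psi_exp[unfolded A_eq]] Psi_x B0 t_power_neq_z[of 0 0]
    by (simp add: x_eq A_eq)

  define \<omega> where "\<omega> = T * l * \<xi>"
  have omega0: "\<omega> \<noteq> 0" using T0 l0 xi0 by (simp add: \<omega>_def)
  \<comment> \<open>The factor T in \<omega> matches the additional 1/(t - \<open>z ^ q\<close>) in
    \<kappa>, so this is \<eta>/l. Division by \<open>l ^ (q - 1)\<close> = Ts/T then turns -(t -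
    \<open>z ^ q\<close>) into -(t - z).\<close>
  define \<eta>s where "\<eta>s = B / ((t - z) * (t - z ^ q)) / \<omega>"
  have etas: "\<eta>s ^ (q - 1) = - (t - z)"
  proof -
    have "\<eta>s = B * Ts * T / \<omega>" by (simp add: \<eta>s_def T_eq Ts)
    then have "\<eta>s ^ (q - 1) = (B * Ts) ^ (q - 1) * T ^ (q - 1) / (T ^ (q - 1) * (Ts / T) * (- T * (B * Ts) ^ (q - 1)))"
      by (simp only: power_divide power_mult_distrib \<omega>_def ell xi_power)
    also have "\<dots> = - (1 / Ts)" using B0 Ts0 T0 by (simp add: field_simps)
    finally show ?thesis by (simp add: Ts)
  qed
  have "is_exp_coeffs q A \<Psi>s (\<lambda>i. exp_num z i * \<eta>s ^ (q ^ i - 1))"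
    using exp_coeffs[of z "z ^ q" \<eta>s F \<Psi>s] Psis Psis_x Psis_y etas cf.F_frob
    unfolding x_noswap T_eq[symmetric] Ts[symmetric] y_eq A by blast
  then have Psis_exp: "is_exp_coeffs q cf.A \<Psi>s (\<lambda>i. exp_num z i * (B / ((t - z) * (t - z ^ q)) / \<omega>) ^ (q ^ i - 1))"
    unfolding \<eta>s_def A_eq .
  have "inverse_ideal K A I = {a + t * b | a b. a \<in> A \<and> b \<in> A}"
    using cf.inverse_ideal_eq[OF tr norm] by (simp add: K I A_eq x_eq y_eq)
  then have "period_lattice q A \<Psi>s = (\<lambda>a. \<omega> * a) ` inverse_ideal K A I"
    using cf.kernel_z[OF _ _ omega0 Psis_exp _ refl refl B] lattice[OF Psis_exp[unfolded A_eq]] Psis_x B0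
      t_power_neq_z[of 0 0] t_power_neq_z[of 0 1]
    by (simp add: x_eq A_eq)
  with lattice_Psi period_product(1)[OF T_eq Ts B(1)] show ?thesis
    unfolding \<omega>_def by blast
qed

end
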